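(* Let $U=\int_X^\oplus U_x\,d\mu(x)$ be a direct integral of real Hilbert spaces with $U_{x+\delta}=U_x$ and $U_{\check x}=U_x$ for all $\delta\in\Delta$ and almost all $x\in X$, let $V_x=\mathbb C\otimes U_x$, and let $(\mu,\nu,\mathcal C)$ be a Gårding–Wightman triple with this family $\{V_x\}$, $\nu(x)=\dim V_x$. If $\check\mu$ is equivalent to $\mu$, $\check\nu(x)=\nu(x)$, and the operators $c_k$ satisfy $$\overline{c_1(x)}=c_1(\check x),\qquad\overline{c_k(x)}=(-1)^kc_k(\check x)\quad\forall k\ge2$$ for almost all $x\in X$, then $$Qf(x)=(-1)^{x_1}\sqrt{\tfrac{d\mu(\check x)}{d\mu(x)}}\;\overline{f(\check x)}$$ is an invariant quaternionic structure in $V(\mu,\nu,\mathcal C)$.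
   Context: $X=\mathbb Z_2^{\infty}$ is the compact abelian group of sequences $x=(x_1,x_2,\dots)$ of $0$'s and $1$'s with componentwise addition mod $2$, the product topology and its Borel $\sigma$-algebra. $\delta^k\in X$ has a $1$ in position $k$ and $0$ elsewhere; $\Delta\subset X$ is the subgroup of sequences with finitely many $1$'s. $\check x=x+(1,1,\dots)$; $\check\nu(x)=\nu(\check x)$ and $\check\mu(A)=\mu(\check A)$, $\check A=\{\check x:x\in A\}$. Measures are equivalent if mutually absolutely continuous. A Gårding–Wightman triple $(\mu,\nu,\mathcal C)$ consists of: (1) a $\sigma$-finite positive Borel measure $\mu$ on $X$, quasi-invariant under $\Delta$, i.e. for each $\delta\in\Delta$ the measure $A\mapsto\mu(A+\delta)$ is equivalent to $\mu$; (2) a measurable family $\{V_x\}$ of nonzero separable complex Hilbert spaces with $V_{x+\delta}=V_x$ for $\delta\in\Delta$ and almost all $x$, and $\nu(x)=\dim V_x$ measurable; (3) a family $\mathcal C=\{c_k(x):k\ge 1,x\in X\}$ of unitary operators $c_k(x):V_x\to V_{x+\delta^k}=V_x$, depending measurably on $x$, with $c_k(x)^*=c_k(x+\delta^k)$ and $c_k(x)c_l(x+\delta^k)=c_l(x)c_k(x+\delta^l)$ for all $k,l$ and almost all $x$. $V=V(\mu,\nu,\mathcal C)=\int_X^\oplus V_x\,d\mu(x)$ carries the mutually anticommuting unitary operators of square $-I$ ($k\ge1$) $$J_kf(x)=-i(-1)^{x_1+\dots+x_{k-1}}c_k(x)\sqrt{\tfrac{d\mu(x+\delta^k)}{d\mu(x)}}f(x+\delta^k),\quad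 J_k'f(x)=(-1)^{x_1+\dots+x_{k}}c_k(x)\sqrt{\tfrac{d\mu(x+\delta^k)}{d\mu(x)}}f(x+\delta^k),$$ where $d\mu(x+\delta^k)/d\mu(x)$ is the Radon–Nikodym derivative of $A\mapsto\mu(A+\delta^k)$ with respect to $\mu$; likewise $d\mu(\check x)/d\mu(x)=d\check\mu/d\mu(x)$. The bar denotes conjugation of $V_x=\mathbb C\otimes U_x$ with respect to $U_x$; for an operator $A$, $\overline A(v)=\overline{A(\bar v)}$. An invariant quaternionic structure is a $\mathbb C$-antilinear norm-preserving operator $Q$ on $V$ with $Q^2=-I$ commuting with all $J_k,J_k'$. *)

theory Defs
  imports "HOL-Analysis.Analysis" "HOL-Library.Extended_Nat"
begin

section \<open>The group of binary sequences\<close>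

text \<open>
  A sequence $(x_1, x_2, \dots)$ is stored as a function on \<open>nat\<close> with \<open>True\<close> for 1, the
  coordinate $x_k$ (for $k \ge 1$) sitting at argument \<open>k - 1\<close>. The topology of
  \<open>nat \<Rightarrow> bool\<close> is the product topology of the discrete one.
\<close>

type_synonym binseq = "nat \<Rightarrow> bool"

definition coord :: "nat \<Rightarrow> binseq \<Rightarrow> nat"
  where "coord k x = of_bool (x (k - 1))"

definition seq_add :: "binseq \<Rightarrow> binseq \<Rightarrow> binseq"  (infixl \<open>\<boxplus>\<close> 65)
  where "x \<boxplus> y = (\<lambda>j. x j \<noteq> y j)"

definition unit_seq :: "nat \<Rightarrow> binseq"
  where "unit_seq k = (\<lambda>j. j = k - 1)"

definition ones :: binseq
  where "ones = (\<lambda>_. True)"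

definition fin_seqs :: "binseq set"
  where "fin_seqs = {d. finite {j. d j}}"

definition flip :: "binseq \<Rightarrow> binseq"
  where "flip x = x \<boxplus> ones"

text \<open>The measure $A \mapsto \mu(A + d)$; note that $A + d$ is the preimage of $A$ under $x \mapsto x + d$.\<close>

definition translate :: "binseq measure \<Rightarrow> binseq \<Rightarrow> binseq measure"
  where "translate \<mu> d = distr \<mu> borel (\<lambda>x. x \<boxplus> d)"

definition equivalent_measures :: "'a measure \<Rightarrow> 'a measure \<Rightarrow> bool"
  where "equivalent_measures M N \<longleftrightarrow> absolutely_continuous M N \<and> absolutely_continuous N M"

definition sqrt_deriv :: "binseq measure \<Rightarrow> binseq \<Rightarrow> binseq \<Rightarrow> real"
  where "sqrt_deriv \<mu> d x = sqrt (enn2real (RN_deriv \<mu> (translate \<mu> d) x))"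


section \<open>Complexification\<close>

text \<open>
  The complexification of a real Hilbert space \<open>'u\<close> is \<open>'u \<times> 'u\<close>, the pair \<open>(a, b)\<close> standing
  for $1 \otimes a + i \otimes b$. The library's norm on the product is the Hilbert norm of the
  complexification. Complex inner products are linear in the first argument.
\<close>

definition cscale :: "complex \<Rightarrow> 'u::real_vector \<times> 'u \<Rightarrow> 'u \<times> 'u"
  where "cscale z v = (Re z *\<^sub>R fst v - Im z *\<^sub>R snd v, Re z *\<^sub>R snd v + Im z *\<^sub>R fst v)"

definition cinner :: "'u::real_inner \<times> 'u \<Rightarrow> 'u \<times> 'u \<Rightarrow> complex"
  where "cinner v w = Complex (fst v \<bullet> fst w + snd v \<bullet> snd w) (snd v \<bullet> fst w - fst v \<bullet> snd w)"

definition conj_vec :: "'u::real_vector \<times> 'u \<Rightarrow> 'u \<times> 'u"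
  where "conj_vec v = (fst v, - snd v)"

definition conj_op :: "('u::real_vector \<times> 'u \<Rightarrow> 'u \<times> 'u) \<Rightarrow> 'u \<times> 'u \<Rightarrow> 'u \<times> 'u"
  where "conj_op A v = conj_vec (A (conj_vec v))"

definition unitary_on :: "('u::real_inner \<times> 'u) set \<Rightarrow> ('u \<times> 'u \<Rightarrow> 'u \<times> 'u) \<Rightarrow> bool"
  where "unitary_on S A \<longleftrightarrow>
    (\<forall>v\<in>S. \<forall>w\<in>S. A (v + w) = A v + A w) \<and>
    (\<forall>z. \<forall>v\<in>S. A (cscale z v) = cscale z (A v)) \<and>
    A ` S = S \<and>
    (\<forall>v\<in>S. \<forall>w\<in>S. cinner (A v) (A w) = cinner v w)"

definition adjoint_on :: "('u::real_inner \<times> 'u) set \<Rightarrow> ('u \<times> 'u \<Rightarrow> 'u \<times> 'u) \<Rightarrow> ('u \<times> 'u \<Rightarrow> 'u \<times> 'u) \<Rightarrow> bool"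
  where "adjoint_on S A B \<longleftrightarrow> (\<forall>v\<in>S. \<forall>w\<in>S. cinner (A v) w = cinner v (B w))"

definition orthonormal_basis :: "('u::real_inner \<times> 'u) set \<Rightarrow> ('u \<times> 'u) set \<Rightarrow> bool"
  where "orthonormal_basis S B \<longleftrightarrow>
    B \<subseteq> S \<and> (\<forall>v\<in>B. cinner v v = 1) \<and> pairwise (\<lambda>v w. cinner v w = 0) B \<and>
    closure (module.span cscale B) = S"

text \<open>For separable spaces; all infinite-dimensional ones get dimension \<open>\<infinity>\<close>.\<close>

definition hilbert_dim :: "('u::real_inner \<times> 'u) set \<Rightarrow> enat"
  where "hilbert_dim S =
    (let B = (SOME B. orthonormal_basis S B) in if finite B then enat (card B) else \<infinity>)"


section \<open>Measurable families of Hilbert spaces\<close>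

text \<open>
  The fibres are closed subspaces of one ambient Hilbert space, which need not be separable. This
  is no restriction: an arbitrary family can be placed in the Hilbert sum of its distinct members.
  The measurable structure does not come from the ambient space but from a fundamental sequence
  \<open>e\<close> of sections, whose values have dense span in every fibre (so the fibres are separable);
  a section is measurable if its inner products with the members of \<open>e\<close> are.

  Measurability is meant with respect to the completion of the measure, because the fibre
  identifications and operators below are only constrained almost everywhere.
\<close>

definition real_measurable_family ::
    "'a measure \<Rightarrow> ('a \<Rightarrow> 'u::{real_inner,complete_space} set) \<Rightarrow> (nat \<Rightarrow> 'a \<Rightarrow> 'u) \<Rightarrow> bool"
  where "real_measurable_family \<mu> U e \<longleftrightarrow>
    (\<forall>x. subspace (U x) \<and> closed (U x)) \<and>
    (\<forall>n x. e n x \<in> U x) \<and>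
    (\<forall>x. closure (span (range (\<lambda>n. e n x))) = U x) \<and>
    (\<forall>m n. (\<lambda>x. e m x \<bullet> e n x) \<in> borel_measurable (completion \<mu>))"

definition real_measurable_section ::
    "'a measure \<Rightarrow> ('a \<Rightarrow> 'u::{real_inner,complete_space} set) \<Rightarrow> (nat \<Rightarrow> 'a \<Rightarrow> 'u) \<Rightarrow> ('a \<Rightarrow> 'u) \<Rightarrow> bool"
  where "real_measurable_section \<mu> U e f \<longleftrightarrow>
    (AE x in \<mu>. f x \<in> U x) \<and> (\<forall>n. (\<lambda>x. f x \<bullet> e n x) \<in> borel_measurable (completion \<mu>))"

definition measurable_family ::
    "'a measure \<Rightarrow> ('a \<Rightarrow> ('u::{real_inner,complete_space} \<times> 'u) set) \<Rightarrow> (nat \<Rightarrow> 'a \<Rightarrow> 'u \<times> 'u) \<Rightarrow> bool"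
  where "measurable_family \<mu> V e \<longleftrightarrow>
    (\<forall>x. module.subspace cscale (V x) \<and> closed (V x)) \<and>
    (\<forall>n x. e n x \<in> V x) \<and>
    (\<forall>x. closure (module.span cscale (range (\<lambda>n. e n x))) = V x) \<and>
    (\<forall>m n. (\<lambda>x. cinner (e m x) (e n x)) \<in> borel_measurable (completion \<mu>))"

definition measurable_section ::
    "'a measure \<Rightarrow> ('a \<Rightarrow> ('u::{real_inner,complete_space} \<times> 'u) set) \<Rightarrow> (nat \<Rightarrow> 'a \<Rightarrow> 'u \<times> 'u) \<Rightarrow>
      ('a \<Rightarrow> 'u \<times> 'u) \<Rightarrow> bool"
  where "measurable_section \<mu> V e f \<longleftrightarrow>
    (AE x in \<mu>. f x \<in> V x) \<and> (\<forall>n. (\<lambda>x. cinner (f x) (e n x)) \<in> borel_measurable (completion \<mu>))"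

text \<open>
  The identity $V_{x+d} = V_x$ for almost all $x$ is one of measurable families: besides the fibres
  it identifies the measurable structures, i.e. translates of the sections \<open>e n\<close> are measurable
  sections. Without this $f(x + d)$ need not be measurable for a measurable section $f$.
\<close>

definition real_translation_invariant ::
    "binseq measure \<Rightarrow> (binseq \<Rightarrow> 'u::{real_inner,complete_space} set) \<Rightarrow> (nat \<Rightarrow> binseq \<Rightarrow> 'u) \<Rightarrow>
      binseq \<Rightarrow> bool"
  where "real_translation_invariant \<mu> U e d \<longleftrightarrow>
    (AE x in \<mu>. U (x \<boxplus> d) = U x) \<and>
    (\<forall>n. real_measurable_section \<mu> U e (\<lambda>x. e n (x \<boxplus> d)))"

definition translation_invariant ::
    "binseq measure \<Rightarrow> (binseq \<Rightarrow> ('u::{real_inner,complete_space} \<times> 'u) set) \<Rightarrow>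
      (nat \<Rightarrow> binseq \<Rightarrow> 'u \<times> 'u) \<Rightarrow> binseq \<Rightarrow> bool"
  where "translation_invariant \<mu> V e d \<longleftrightarrow>
    (AE x in \<mu>. V (x \<boxplus> d) = V x) \<and>
    (\<forall>n. measurable_section \<mu> V e (\<lambda>x. e n (x \<boxplus> d)))"

definition complexify_family :: "('a \<Rightarrow> 'u set) \<Rightarrow> 'a \<Rightarrow> ('u \<times> 'u) set"
  where "complexify_family U x = U x \<times> U x"

definition complexify_sections :: "(nat \<Rightarrow> 'a \<Rightarrow> 'u::real_vector) \<Rightarrow> nat \<Rightarrow> 'a \<Rightarrow> 'u \<times> 'u"
  where "complexify_sections e n x = (e n x, 0)"


section \<open>Garding--Wightman triples\<close>

text \<open>The operators $c_k$ matter only for $k \ge 1$, and \<open>c k x\<close> only on \<open>V x\<close>.\<close>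

definition GW_triple ::
    "binseq measure \<Rightarrow> (binseq \<Rightarrow> ('u::{real_inner,complete_space} \<times> 'u) set) \<Rightarrow>
      (nat \<Rightarrow> binseq \<Rightarrow> 'u \<times> 'u) \<Rightarrow> (binseq \<Rightarrow> enat) \<Rightarrow>
      (nat \<Rightarrow> binseq \<Rightarrow> 'u \<times> 'u \<Rightarrow> 'u \<times> 'u) \<Rightarrow> bool"
  where "GW_triple \<mu> V e \<nu> c \<longleftrightarrow>
    sets \<mu> = sets borel \<and> sigma_finite_measure \<mu> \<and>
    (\<forall>d\<in>fin_seqs. equivalent_measures (translate \<mu> d) \<mu>) \<and>
    measurable_family \<mu> V e \<and> (\<forall>x. V x \<noteq> {0}) \<and>
    (\<forall>d\<in>fin_seqs. translation_invariant \<mu> V e d) \<and>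
    (\<forall>x. \<nu> x = hilbert_dim (V x)) \<and> \<nu> \<in> measurable (completion \<mu>) (count_space UNIV) \<and>
    (\<forall>k\<ge>1. AE x in \<mu>. unitary_on (V x) (c k x)) \<and>
    (\<forall>k\<ge>1. \<forall>f. measurable_section \<mu> V e f \<longrightarrow> measurable_section \<mu> V e (\<lambda>x. c k x (f x))) \<and>
    (\<forall>k\<ge>1. AE x in \<mu>. adjoint_on (V x) (c k x) (c k (x \<boxplus> unit_seq k))) \<and>
    (\<forall>k\<ge>1. \<forall>l\<ge>1. AE x in \<mu>. \<forall>v\<in>V x.
       c k x (c l (x \<boxplus> unit_seq k) v) = c l x (c k (x \<boxplus> unit_seq l) v))"


section \<open>The direct integral and its operators\<close>

text \<open>
  Elements of the direct integral are classes of square-integrable measurable sections modulo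
  equality almost everywhere. An operator given by a formula on sections is transferred to
  classes by \<open>lift_op\<close>.
\<close>

definition L2_sections ::
    "'a measure \<Rightarrow> ('a \<Rightarrow> ('u::{real_inner,complete_space} \<times> 'u) set) \<Rightarrow> (nat \<Rightarrow> 'a \<Rightarrow> 'u \<times> 'u) \<Rightarrow>
      ('a \<Rightarrow> 'u \<times> 'u) set"
  where "L2_sections \<mu> V e =
    {f. measurable_section \<mu> V e f \<and> integrable (completion \<mu>) (\<lambda>x. (norm (f x))\<^sup>2)}"

definition section_eq ::
    "'a measure \<Rightarrow> ('a \<Rightarrow> ('u::{real_inner,complete_space} \<times> 'u) set) \<Rightarrow> (nat \<Rightarrow> 'a \<Rightarrow> 'u \<times> 'u) \<Rightarrow>
      (('a \<Rightarrow> 'u \<times> 'u) \<times> ('a \<Rightarrow> 'u \<times> 'u)) set"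
  where "section_eq \<mu> V e =
    {(f, g). f \<in> L2_sections \<mu> V e \<and> g \<in> L2_sections \<mu> V e \<and> (AE x in \<mu>. f x = g x)}"

definition direct_integral ::
    "'a measure \<Rightarrow> ('a \<Rightarrow> ('u::{real_inner,complete_space} \<times> 'u) set) \<Rightarrow> (nat \<Rightarrow> 'a \<Rightarrow> 'u \<times> 'u) \<Rightarrow>
      ('a \<Rightarrow> 'u \<times> 'u) set set"
  where "direct_integral \<mu> V e = L2_sections \<mu> V e // section_eq \<mu> V e"

definition lift_op ::
    "'a measure \<Rightarrow> ('a \<Rightarrow> ('u::{real_inner,complete_space} \<times> 'u) set) \<Rightarrow> (nat \<Rightarrow> 'a \<Rightarrow> 'u \<times> 'u) \<Rightarrow>
      (('a \<Rightarrow> 'u \<times> 'u) \<Rightarrow> 'a \<Rightarrow> 'u \<times> 'u) \<Rightarrow> ('a \<Rightarrow> 'u \<times> 'u) set \<Rightarrow> ('a \<Rightarrow> 'u \<times> 'u) set"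
  where "lift_op \<mu> V e T A = section_eq \<mu> V e `` (T ` A)"

definition dint_add ::
    "'a measure \<Rightarrow> ('a \<Rightarrow> ('u::{real_inner,complete_space} \<times> 'u) set) \<Rightarrow> (nat \<Rightarrow> 'a \<Rightarrow> 'u \<times> 'u) \<Rightarrow>
      ('a \<Rightarrow> 'u \<times> 'u) set \<Rightarrow> ('a \<Rightarrow> 'u \<times> 'u) set \<Rightarrow> ('a \<Rightarrow> 'u \<times> 'u) set"
  where "dint_add \<mu> V e A B = section_eq \<mu> V e `` {(\<lambda>x. f x + g x) | f g. f \<in> A \<and> g \<in> B}"

definition dint_scale ::
    "'a measure \<Rightarrow> ('a \<Rightarrow> ('u::{real_inner,complete_space} \<times> 'u) set) \<Rightarrow> (nat \<Rightarrow> 'a \<Rightarrow> 'u \<times> 'u) \<Rightarrow>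
      complex \<Rightarrow> ('a \<Rightarrow> 'u \<times> 'u) set \<Rightarrow> ('a \<Rightarrow> 'u \<times> 'u) set"
  where "dint_scale \<mu> V e z = lift_op \<mu> V e (\<lambda>f x. cscale z (f x))"

definition dint_norm :: "'a measure \<Rightarrow> ('a \<Rightarrow> 'u::{real_inner,complete_space} \<times> 'u) set \<Rightarrow> real"
  where "dint_norm \<mu> A = (THE r. \<forall>f\<in>A. r = sqrt (LINT x|completion \<mu>. (norm (f x))\<^sup>2))"

definition J_section ::
    "binseq measure \<Rightarrow> (nat \<Rightarrow> binseq \<Rightarrow> 'u::{real_inner,complete_space} \<times> 'u \<Rightarrow> 'u \<times> 'u) \<Rightarrow> nat \<Rightarrow>
      (binseq \<Rightarrow> 'u \<times> 'u) \<Rightarrow> binseq \<Rightarrow> 'u \<times> 'u"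
  where "J_section \<mu> c k f x =
    cscale (- \<i> * (-1) ^ (\<Sum>j\<in>{1..<k}. coord j x) * complex_of_real (sqrt_deriv \<mu> (unit_seq k) x))
      (c k x (f (x \<boxplus> unit_seq k)))"

definition J'_section ::
    "binseq measure \<Rightarrow> (nat \<Rightarrow> binseq \<Rightarrow> 'u::{real_inner,complete_space} \<times> 'u \<Rightarrow> 'u \<times> 'u) \<Rightarrow> nat \<Rightarrow>
      (binseq \<Rightarrow> 'u \<times> 'u) \<Rightarrow> binseq \<Rightarrow> 'u \<times> 'u"
  where "J'_section \<mu> c k f x =
    cscale ((-1) ^ (\<Sum>j\<in>{1..k}. coord j x) * complex_of_real (sqrt_deriv \<mu> (unit_seq k) x))
      (c k x (f (x \<boxplus> unit_seq k)))"

definition Q_section ::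
    "binseq measure \<Rightarrow> (binseq \<Rightarrow> 'u::{real_inner,complete_space} \<times> 'u) \<Rightarrow> binseq \<Rightarrow> 'u \<times> 'u"
  where "Q_section \<mu> f x =
    cscale ((-1) ^ coord 1 x * complex_of_real (sqrt_deriv \<mu> ones x)) (conj_vec (f (flip x)))"

definition invariant_quaternionic_structure ::
    "binseq measure \<Rightarrow> (binseq \<Rightarrow> ('u::{real_inner,complete_space} \<times> 'u) set) \<Rightarrow>
      (nat \<Rightarrow> binseq \<Rightarrow> 'u \<times> 'u) \<Rightarrow> (nat \<Rightarrow> binseq \<Rightarrow> 'u \<times> 'u \<Rightarrow> 'u \<times> 'u) \<Rightarrow>
      ((binseq \<Rightarrow> 'u \<times> 'u) set \<Rightarrow> (binseq \<Rightarrow> 'u \<times> 'u) set) \<Rightarrow> bool"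
  where "invariant_quaternionic_structure \<mu> V e c Q \<longleftrightarrow>
    Q \<in> direct_integral \<mu> V e \<rightarrow> direct_integral \<mu> V e \<and>
    (\<forall>A\<in>direct_integral \<mu> V e. \<forall>B\<in>direct_integral \<mu> V e.
       Q (dint_add \<mu> V e A B) = dint_add \<mu> V e (Q A) (Q B)) \<and>
    (\<forall>z. \<forall>A\<in>direct_integral \<mu> V e. Q (dint_scale \<mu> V e z A) = dint_scale \<mu> V e (cnj z) (Q A)) \<and>
    (\<forall>A\<in>direct_integral \<mu> V e. dint_norm \<mu> (Q A) = dint_norm \<mu> A) \<and>
    (\<forall>A\<in>direct_integral \<mu> V e. Q (Q A) = dint_scale \<mu> V e (-1) A) \<and>
    (\<forall>k\<ge>1. \<forall>A\<in>direct_integral \<mu> V e.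
       Q (lift_op \<mu> V e (J_section \<mu> c k) A) = lift_op \<mu> V e (J_section \<mu> c k) (Q A)) \<and>
    (\<forall>k\<ge>1. \<forall>A\<in>direct_integral \<mu> V e.
       Q (lift_op \<mu> V e (J'_section \<mu> c k) A) = lift_op \<mu> V e (J'_section \<mu> c k) (Q A))"

end

theory Submission
  imports Defs
begin

text \<open>
  Write $s_d(x) = \sqrt{d\mu(x + d)/d\mu(x)}$. The chain rule for Radon--Nikodym derivatives makes
  $s$ a multiplicative cocycle: $s_{d + d'}(x) = s_d(x + d')\, s_{d'}(x)$ almost everywhere. Hence
  every operator $f \mapsto z(x)\, s_d(x)\, B_x f(x + d)$ with unimodular $z$ and norm-preserving
  $B_x$ is isometric, and the weights of $Q J_k$ and $J_k Q$ agree; the remaining signs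
  are balanced by the conjugation rule for $c_k$. That $f(x + d)$ is again a measurable section rests
  on the measurability of the inner product of two measurable sections.
\<close>

section \<open>Inner products of measurable sections\<close>

text \<open>A section is not known to be a Borel map into the ambient space, which need not be
  separable. What is given is the measurability of countably many inner products, so even the norm
  of a section has to be recovered from a countable dense subset of each fibre. The signs balance as
  follows. In Q J_k the phase of J_k is evaluated at the flipped point, which yields (-1)^(k-1), and
  -i is conjugated, which yields one more -1. The phase of J'_k involves one more coordinate but no
  i, so in both cases the total is (-1)^k. In J_k Q the factor (-1)^(x_1) of Q is evaluated at x +
  delta^k and changes sign exactly when k = 1. The conjugation rule therefore has to supply (-1)^k
  for k \<ge> 2 but 1 for k = 1. The identity Q^2 = -I comes from x_1 taking opposite values in two
  successive applications of Q.\<close>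

definition rat_comb :: "(nat \<Rightarrow> 'u::real_vector) \<Rightarrow> (rat \<times> nat) list \<Rightarrow> 'u"
  where "rat_comb v qs = (\<Sum>(q, n)\<leftarrow>qs. of_rat q *\<^sub>R v n)"

text \<open>Coefficient lists are a countable type, and concatenation makes their combinations
  additive without any normal form for the coefficients.\<close>

lemma rat_comb_append: "rat_comb v (qs @ rs) = rat_comb v qs + rat_comb v rs"
  by (simp add: rat_comb_def)

lemma rat_comb_scale: "rat_comb v (map (\<lambda>(q, n). (r * q, n)) qs) = of_rat r *\<^sub>R rat_comb v qs"
  by (induction qs) (auto simp: rat_comb_def of_rat_mult scaleR_add_right)

lemma real_in_closure_Rats: "(c::real) \<in> closure \<rat>"
  unfolding closure_approachable
proof safe
  fix \<epsilon> :: real assume "0 < \<epsilon>"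
  then obtain q where "c - \<epsilon> < of_rat q" "of_rat q < c"
    using of_rat_dense[of "c - \<epsilon>" c] by auto
  then show "\<exists>y\<in>\<rat>. dist y c < \<epsilon>"
    by (intro bexI[of _ "of_rat q"]) (auto simp: dist_real_def)
qed

text \<open>The combinations themselves admit only rational scalars. In the closure a real multiple
  is the limit of rational multiples of approximating combinations, because scaling is jointly
  continuous.\<close>

lemma subspace_closure_rat_comb:
  fixes v :: "nat \<Rightarrow> 'u::real_normed_vector"
  shows "subspace (closure (range (rat_comb v)))"
proof -
  define D where "D = range (rat_comb v)"
  have add: "x + y \<in> closure D" if "x \<in> closure D" "y \<in> closure D" for x y
  proof -
    from that(1) obtain s where s: "\<And>n::nat. s n \<in> D" "s \<longlonglongrightarrow> x"
      by (meson closure_sequential)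
    from that(2) obtain t where t: "\<And>n::nat. t n \<in> D" "t \<longlonglongrightarrow> y"
      by (meson closure_sequential)
    have "s n + t n \<in> D" for n
    proof -
      obtain qs rs where "s n = rat_comb v qs" "t n = rat_comb v rs"
        using s(1)[of n] t(1)[of n] unfolding D_def by blast
      then show ?thesis
        by (simp add: D_def flip: rat_comb_append)
    qed
    moreover have "(\<lambda>n. s n + t n) \<longlonglongrightarrow> x + y"
      using s(2) t(2) by (rule tendsto_add)
    ultimately show ?thesis
      by (meson closure_sequential)
  qed
  have scale: "r *\<^sub>R x \<in> closure D" if "x \<in> closure D" for x r
  proof -
    from that obtain s where s: "\<And>n::nat. s n \<in> D" "s \<longlonglongrightarrow> x"
      by (meson closure_sequential)
    obtain q where q: "\<And>n::nat. q n \<in> \<rat>" "q \<longlonglongrightarrow> r"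
      using real_in_closure_Rats[of r] by (meson closure_sequential)
    have "q n *\<^sub>R s n \<in> D" for n
    proof -
      obtain p where "q n = of_rat p"
        using q(1)[of n] by (rule Rats_cases)
      moreover obtain qs where "s n = rat_comb v qs"
        using s(1)[of n] unfolding D_def by blast
      ultimately show ?thesis
        by (simp add: D_def flip: rat_comb_scale)
    qed
    moreover have "(\<lambda>n. q n *\<^sub>R s n) \<longlonglongrightarrow> r *\<^sub>R x"
      using q(2) s(2) by (rule tendsto_scaleR)
    ultimately show ?thesis
      by (meson closure_sequential)
  qed
  have "rat_comb v [] = 0"
    by (simp add: rat_comb_def)
  then have "0 \<in> closure D"
    using closure_subset[of D] rangeI[of "rat_comb v" "[]"] by (auto simp: D_def)
  with add scale show ?thesis
    by (auto simp: subspace_def D_def)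
qed

text \<open>Makes the rational combinations a countable dense set for a fibre: the closure on the
  right is a closed subspace containing every \<open>v n\<close>.\<close>

lemma closure_span_subset_closure_rat_comb:
  fixes v :: "nat \<Rightarrow> 'u::real_normed_vector"
  shows "closure (span (range v)) \<subseteq> closure (range (rat_comb v))"
proof -
  have "v n \<in> range (rat_comb v)" for n
    using rangeI[of "rat_comb v" "[(1, n)]"] by (simp add: rat_comb_def)
  then have "range v \<subseteq> closure (range (rat_comb v))"
    using closure_subset[of "range (rat_comb v)"] by blast
  then have "span (range v) \<subseteq> closure (range (rat_comb v))"
    using subspace_closure_rat_comb by (rule span_minimal)
  then show ?thesis
    by (simp add: closure_minimal)
qed

text \<open>Expresses the norm through the countably many inner products that are known to be measurable.\<close>

lemma norm_greater_iff_rat_comb: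
  fixes v :: "nat \<Rightarrow> 'u::real_inner"
  assumes "x \<in> closure (span (range v))" and "0 \<le> a"
  shows "a < norm x \<longleftrightarrow> (\<exists>qs. a * norm (rat_comb v qs) < x \<bullet> rat_comb v qs)"
proof
  assume a: "a < norm x"
  \<comment> \<open>The condition on y is open and holds at y = x, hence at some rational
    combination close to x. Not dividing by \<open>norm y\<close> spares a case distinction: y = 0
    fails the strict inequality by itself.\<close>
  define S where "S = {y. a * norm y < x \<bullet> y}"
  have S: "open S"
    unfolding S_def
    by (rule open_Collect_less)
      (auto intro!: continuous_on_mult continuous_on_norm continuous_on_inner continuous_on_const continuous_on_id)
  have "a * norm x < norm x * norm x"
    using a \<open>0 \<le> a\<close> by (intro mult_strict_right_mono) linarith+
  then have xS: "x \<in> S"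
    by (simp only: S_def mem_Collect_eq dot_square_norm power2_eq_square)
  have xD: "x \<in> closure (range (rat_comb v))"
    using assms(1) closure_span_subset_closure_rat_comb by (rule rev_subsetD)
  have "S \<inter> range (rat_comb v) \<noteq> {}"
  proof
    assume "S \<inter> range (rat_comb v) = {}"
    then have "S \<inter> closure (range (rat_comb v)) = {}"
      using open_Int_closure_eq_empty[OF S] by (rule iffD2[rotated])
    with IntI[OF xS xD] show False
      by (metis empty_iff)
  qed
  then obtain y where "y \<in> S" "y \<in> range (rat_comb v)"
    by blast
  then obtain qs where "rat_comb v qs \<in> S"
    by (metis imageE)
  then have "a * norm (rat_comb v qs) < x \<bullet> rat_comb v qs"
    by (simp only: S_def mem_Collect_eq)
  then show "\<exists>qs. a * norm (rat_comb v qs) < x \<bullet> rat_comb v qs" ..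
next
  assume "\<exists>qs. a * norm (rat_comb v qs) < x \<bullet> rat_comb v qs"
  then obtain y where y: "a * norm y < x \<bullet> y" by blast
  show "a < norm x"
  proof (rule ccontr)
    assume "\<not> a < norm x"
    then have "norm x * norm y \<le> a * norm y"
      by (intro mult_right_mono) auto
    also have "\<dots> < x \<bullet> y" by (rule y)
    also have "\<dots> \<le> norm x * norm y" by (rule norm_cauchy_schwarz)
    finally show False by simp
  qed
qed

text \<open>The preimages under \<open>f\<close> and \<open>g\<close> differ only inside a null set,
  and the completion contains all subsets of null sets. This is what permits changing a section on a
  null set.\<close>

lemma borel_measurable_completion_AE:
  assumes "f \<in> borel_measurable (completion M)" and "AE x in M. f x = g x"
  shows "g \<in> borel_measurable (completion M)"
proof (rule measurableI)
  fix A :: "'b set" assume A: "A \<in> sets borel"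
  show "g -` A \<inter> space (completion M) \<in> sets (completion M)"
    using assms(2)
    by (intro completion.in_sets_AE[OF _ measurable_sets[OF assms(1) A]])
       (auto simp: AE_completion_iff elim!: eventually_mono)
qed simp

lemma real_measurable_section_inner:
  "real_measurable_section M U e f \<Longrightarrow> (\<lambda>x. f x \<bullet> e n x) \<in> borel_measurable (completion M)"
  by (simp add: real_measurable_section_def)

section \<open>Operations on real measurable sections\<close>

context
  fixes M :: "'a measure" and U :: "'a \<Rightarrow> 'u::{real_inner,complete_space} set"
    and e :: "nat \<Rightarrow> 'a \<Rightarrow> 'u"
  assumes fam: "real_measurable_family M U e"
begin

lemma fundamental_section: "real_measurable_section M U e (e n)"
  using fam by (auto simp: real_measurable_family_def real_measurable_section_def)

lemma real_measurable_section_cong: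
  assumes "real_measurable_section M U e f" and "AE x in M. f x = g x"
  shows "real_measurable_section M U e g"
  unfolding real_measurable_section_def
proof safe
  have "AE x in M. f x \<in> U x"
    using assms(1) by (simp add: real_measurable_section_def)
  with assms(2) show "AE x in M. g x \<in> U x"
    by eventually_elim simp
  fix n
  show "(\<lambda>x. g x \<bullet> e n x) \<in> borel_measurable (completion M)"
  proof (rule borel_measurable_completion_AE)
    show "(\<lambda>x. f x \<bullet> e n x) \<in> borel_measurable (completion M)"
      using assms(1) by (simp add: real_measurable_section_def)
    show "AE x in M. f x \<bullet> e n x = g x \<bullet> e n x"
      using assms(2) by eventually_elim simp
  qed
qed

lemma real_measurable_section_add:
  assumes "real_measurable_section M U e f" and "real_measurable_section M U e g"
  shows "real_measurable_section M U e (\<lambda>x. f x + g x)"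
proof -
  have "AE x in M. f x \<in> U x" "AE x in M. g x \<in> U x"
    using assms by (auto simp: real_measurable_section_def)
  then have "AE x in M. f x + g x \<in> U x"
    by eventually_elim (use fam in \<open>auto simp: real_measurable_family_def intro: subspace_add\<close>)
  moreover have "(\<lambda>x. (f x + g x) \<bullet> e n x) \<in> borel_measurable (completion M)" for n
    unfolding inner_add_left
    using assms by (intro borel_measurable_add real_measurable_section_inner)
  ultimately show ?thesis
    by (simp add: real_measurable_section_def)
qed

lemma real_measurable_section_scaleR:
  assumes "real_measurable_section M U e f" and "r \<in> borel_measurable (completion M)"
  shows "real_measurable_section M U e (\<lambda>x. r x *\<^sub>R f x)"
proof -
  have "AE x in M. f x \<in> U x"
    using assms by (auto simp: real_measurable_section_def)
  then have "AE x in M. r x *\<^sub>R f x \<in> U x"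
    by eventually_elim (use fam in \<open>auto simp: real_measurable_family_def intro: subspace_scale\<close>)
  moreover have "(\<lambda>x. r x *\<^sub>R f x \<bullet> e n x) \<in> borel_measurable (completion M)" for n
    unfolding inner_scaleR_left
    using assms by (intro borel_measurable_times real_measurable_section_inner)
  ultimately show ?thesis
    by (simp add: real_measurable_section_def)
qed

lemma real_measurable_section_diff:
  assumes "real_measurable_section M U e f" and "real_measurable_section M U e g"
  shows "real_measurable_section M U e (\<lambda>x. f x - g x)"
  using real_measurable_section_add[OF assms(1) real_measurable_section_scaleR[OF assms(2), of "\<lambda>_. -1"]]
  by simp

lemma real_measurable_section_rat_comb:
  "real_measurable_section M U e (\<lambda>x. rat_comb (\<lambda>n. e n x) qs)"
proof (induction qs)
  case Nil
  then show ?case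
    using real_measurable_section_scaleR[OF fundamental_section, of "\<lambda>_. 0" 0] by (simp add: rat_comb_def)
next
  case (Cons p qs)
  then show ?case
    using real_measurable_section_add[OF real_measurable_section_scaleR[OF fundamental_section, of "\<lambda>_. of_rat (fst p)" "snd p"] Cons]
    by (simp add: rat_comb_def split_beta)
qed

lemma inner_rat_comb_measurable:
  assumes "real_measurable_section M U e f"
  shows "(\<lambda>x. f x \<bullet> rat_comb (\<lambda>n. e n x) qs) \<in> borel_measurable (completion M)"
proof (induction qs)
  case (Cons p qs)
  then show ?case
    using borel_measurable_add[OF borel_measurable_times[OF borel_measurable_const[of "of_rat (fst p)"]
          real_measurable_section_inner[OF assms, of "snd p"]] Cons]
    by (simp add: rat_comb_def inner_add_right split_beta)
qed (simp add: rat_comb_def)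

text \<open>\<open>norm_greater_iff_rat_comb\<close> turns each superlevel set of the norm into a
  countable union of sets given by measurable inner products.\<close>

lemma norm_measurable_section:
  assumes f: "real_measurable_section M U e f"
  shows "(\<lambda>x. norm (f x)) \<in> borel_measurable (completion M)"
proof -
  \<comment> \<open>The dense combinations only reach vectors of the fibre, and \<open>f\<close> may
    leave its fibre on a null set; there it is replaced by 0, which lies in every fibre.\<close>
  define g where "g x = (if f x \<in> U x then f x else 0)" for x
  have fg: "AE x in M. f x = g x"
    using f unfolding real_measurable_section_def by (auto simp: g_def elim: eventually_mono)
  have gU: "g x \<in> closure (span (range (\<lambda>n. e n x)))" for x
    using fam by (auto simp: g_def real_measurable_family_def subspace_0)
  have rr: "(\<lambda>x. norm (rat_comb (\<lambda>n. e n x) qs)) \<in> borel_measurable (completion M)" for qs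
    unfolding norm_eq_sqrt_inner
    using inner_rat_comb_measurable[OF real_measurable_section_rat_comb] by simp
  have gr: "(\<lambda>x. g x \<bullet> rat_comb (\<lambda>n. e n x) qs) \<in> borel_measurable (completion M)" for qs
    using inner_rat_comb_measurable real_measurable_section_cong[OF f fg] by blast
  have "(\<lambda>x. norm (g x)) \<in> borel_measurable (completion M)"
    unfolding borel_measurable_iff_greater
  proof
    fix a
    show "{x \<in> space (completion M). a < norm (g x)} \<in> sets (completion M)"
    proof (cases "0 \<le> a")
      case True
      have "{x \<in> space (completion M). a < norm (g x)} =
        (\<Union>qs. {x \<in> space (completion M). a * norm (rat_comb (\<lambda>n. e n x) qs) < g x \<bullet> rat_comb (\<lambda>n. e n x) qs})"
        using norm_greater_iff_rat_comb[OF gU True] by blast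
      \<comment> \<open>The union is over lists of pairs of a rational and a natural number, hence
        countable.\<close>
      also have "\<dots> \<in> sets (completion M)"
        using rr gr by (intro sets.countable_UN'' borel_measurable_less borel_measurable_times) auto
      finally show ?thesis .
    next
      case False
      then have "{x \<in> space (completion M). a < norm (g x)} = space (completion M)"
        by (auto simp: not_le intro: less_le_trans[OF _ norm_ge_zero])
      then show ?thesis by (metis sets.top)
    qed
  qed
  moreover have "AE x in M. norm (g x) = norm (f x)"
    using fg by eventually_elim simp
  ultimately show ?thesis
    by (rule borel_measurable_completion_AE)
qed

text \<open>Polarisation reduces this to norms. The definition of a measurable section covers only
  inner products with the \<open>e n\<close>, whereas translating sections requires those with
  translates of the \<open>e n\<close>.\<close>

lemma inner_measurable_sections:
  assumes "real_measurable_section M U e f" and "real_measurable_section M U e g"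
  shows "(\<lambda>x. f x \<bullet> g x) \<in> borel_measurable (completion M)"
proof -
  have "f x \<bullet> g x = ((norm (f x + g x))\<^sup>2 - (norm (f x - g x))\<^sup>2) / 4" for x
    by (simp add: power2_norm_eq_inner inner_diff inner_add inner_commute)
  then have "(\<lambda>x. f x \<bullet> g x) = (\<lambda>x. ((norm (f x + g x))\<^sup>2 - (norm (f x - g x))\<^sup>2) / 4)"
    by (rule ext)
  moreover have "(\<lambda>x. ((norm (f x + g x))\<^sup>2 - (norm (f x - g x))\<^sup>2) / 4) \<in> borel_measurable (completion M)"
    using norm_measurable_section[OF real_measurable_section_add[OF assms]]
      norm_measurable_section[OF real_measurable_section_diff[OF assms]]
    by (intro borel_measurable_divide borel_measurable_diff borel_measurable_power borel_measurable_const)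
  ultimately show ?thesis by (simp only:)
qed

end

section \<open>The Radon--Nikodym cocycle\<close>

lemma seq_add_assoc: "(x \<boxplus> y) \<boxplus> z = x \<boxplus> (y \<boxplus> z)"
  by (auto simp: seq_add_def)

lemma seq_add_commute: "x \<boxplus> y = y \<boxplus> x"
  by (auto simp: seq_add_def)

lemma seq_add_cancel [simp]: "(x \<boxplus> d) \<boxplus> d = x"
  by (auto simp: seq_add_def)

lemma measurable_coordinate: "(\<lambda>x. x j) \<in> measurable (borel :: binseq measure) (count_space UNIV)"
proof (rule measurableI)
  fix A :: "bool set"
  have "open ((\<lambda>x::binseq. x j) -` A)"
    by (intro open_vimage open_discrete continuous_on_product_coordinates)
  then show "(\<lambda>x. x j) -` A \<inter> space (borel :: binseq measure) \<in> sets borel"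
    by simp
qed simp

lemma measurable_seq_add: "(\<lambda>x. x \<boxplus> d) \<in> borel_measurable (borel :: binseq measure)"
proof (rule borel_measurable_continuous_onI)
  have "continuous_on UNIV (\<lambda>b::bool. b \<noteq> c)" for c
    by simp
  then have "continuous_on UNIV (\<lambda>x::binseq. x j \<noteq> d j)" for j
    by (rule continuous_on_compose2[OF _ continuous_on_product_coordinates]) simp
  then show "continuous_on UNIV (\<lambda>x. x \<boxplus> d)"
    unfolding seq_add_def by (rule continuous_on_coordinatewise_then_product)
qed

locale binseq_measure = sigma_finite_measure \<mu> for \<mu> :: "binseq measure" +
  assumes sets_eq: "sets \<mu> = sets borel"
begin

abbreviation quasi_invariant :: "binseq \<Rightarrow> bool"
  where "quasi_invariant d \<equiv> equivalent_measures (translate \<mu> d) \<mu>"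

abbreviation RN :: "binseq \<Rightarrow> binseq \<Rightarrow> ennreal"
  where "RN d \<equiv> RN_deriv \<mu> (translate \<mu> d)"

lemma measurable_translation: "(\<lambda>x. x \<boxplus> d) \<in> measurable \<mu> \<mu>"
  using measurable_seq_add sets_eq by (simp cong: measurable_cong_sets)

lemma measurable_translation_borel: "(\<lambda>x. x \<boxplus> d) \<in> measurable \<mu> borel"
  using measurable_seq_add sets_eq by (simp cong: measurable_cong_sets)

text \<open>A null set of \<open>\<mu>\<close> is null for \<open>translate \<mu> d\<close>, so its
  preimage under the translation is null as well.\<close>

lemma AE_translate:
  assumes "quasi_invariant d" and "AE x in \<mu>. P x"
  shows "AE x in \<mu>. P (x \<boxplus> d)"
proof -
  have "AE x in translate \<mu> d. P x"
    using assms sets_eq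
    by (intro absolutely_continuous_AE[of "translate \<mu> d" \<mu>])
      (auto simp: translate_def equivalent_measures_def)
  then show ?thesis
    unfolding translate_def by (rule AE_distrD[OF measurable_translation_borel])
qed

text \<open>Measurability passes to the completed target because preimages of null sets are null,
  which is where quasi-invariance enters.\<close>

lemma measurable_completion_translation:
  assumes "quasi_invariant d"
  shows "(\<lambda>x. x \<boxplus> d) \<in> measurable (completion \<mu>) (completion \<mu>)"
proof (rule completion.measurable_completion2)
  show "(\<lambda>x. x \<boxplus> d) \<in> measurable (completion \<mu>) \<mu>"
    using measurable_translation by (rule measurable_completion)
  have "distr \<mu> \<mu> (\<lambda>x. x \<boxplus> d) = translate \<mu> d"
    unfolding translate_def using sets_eq by (rule distr_cong[OF refl]) simp
  then have "distr (completion \<mu>) \<mu> (\<lambda>x. x \<boxplus> d) = translate \<mu> d"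
    by (simp add: distr_completion measurable_translation)
  with assms show "null_sets \<mu> \<subseteq> null_sets (distr (completion \<mu>) \<mu> (\<lambda>x. x \<boxplus> d))"
    by (simp add: equivalent_measures_def absolutely_continuous_def)
qed

lemma density_RN:
  assumes "quasi_invariant d"
  shows "density \<mu> (RN d) = translate \<mu> d"
  using assms sets_eq
  by (intro density_RN_deriv) (auto simp: equivalent_measures_def translate_def)

lemma nn_integral_translate_borel:
  assumes "quasi_invariant d" and "g \<in> borel_measurable \<mu>"
  shows "(\<integral>\<^sup>+x. g (x \<boxplus> d) \<partial>\<mu>) = (\<integral>\<^sup>+x. RN d x * g x \<partial>\<mu>)"
proof -
  have "g \<in> borel_measurable borel"
    using assms(2) sets_eq by (simp cong: measurable_cong_sets)
  then have "(\<integral>\<^sup>+x. g (x \<boxplus> d) \<partial>\<mu>) = (\<integral>\<^sup>+x. g x \<partial>translate \<mu> d)"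
    unfolding translate_def by (simp add: nn_integral_distr measurable_translation_borel)
  also have "\<dots> = (\<integral>\<^sup>+x. g x \<partial>density \<mu> (RN d))"
    by (simp add: density_RN[OF assms(1)])
  also have "\<dots> = (\<integral>\<^sup>+x. RN d x * g x \<partial>\<mu>)"
    using assms(2) by (intro nn_integral_density) auto
  finally show ?thesis .
qed

text \<open>A Borel representative of \<open>g\<close> changes neither integral: on the left the
  exceptional null set is translated, and stays null by \<open>AE_translate\<close>.\<close>

lemma nn_integral_translate:
  assumes "quasi_invariant d" and "g \<in> borel_measurable (completion \<mu>)"
  shows "(\<integral>\<^sup>+x. g (x \<boxplus> d) \<partial>\<mu>) = (\<integral>\<^sup>+x. RN d x * g x \<partial>\<mu>)"
proof -
  obtain h where h: "h \<in> borel_measurable \<mu>" and gh: "AE x in \<mu>. g x = h x"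
    using completion_ex_borel_measurable[OF assms(2)] by blast
  have "(\<integral>\<^sup>+x. g (x \<boxplus> d) \<partial>\<mu>) = (\<integral>\<^sup>+x. h (x \<boxplus> d) \<partial>\<mu>)"
    using AE_translate[OF assms(1) gh] by (rule nn_integral_cong_AE)
  also have "\<dots> = (\<integral>\<^sup>+x. RN d x * h x \<partial>\<mu>)"
    using assms(1) h by (rule nn_integral_translate_borel)
  also have "\<dots> = (\<integral>\<^sup>+x. RN d x * g x \<partial>\<mu>)"
    using gh by (intro nn_integral_cong_AE) (auto elim: eventually_mono)
  finally show ?thesis .
qed

text \<open>By uniqueness of the derivative it suffices to compare densities, and two changes of
  variables, first by \<open>d'\<close> and then by \<open>d\<close>, do so.\<close>

lemma RN_cocycle:
  assumes d: "quasi_invariant d" and d': "quasi_invariant d'"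
  shows "AE x in \<mu>. RN d (x \<boxplus> d') * RN d' x = RN (d \<boxplus> d') x"
proof (rule RN_deriv_unique)
  have RNt: "(\<lambda>x. RN d (x \<boxplus> d')) \<in> borel_measurable \<mu>"
    using measurable_translation borel_measurable_RN_deriv by (rule measurable_compose)
  then show meas: "(\<lambda>x. RN d (x \<boxplus> d') * RN d' x) \<in> borel_measurable \<mu>"
    by (intro borel_measurable_times_ennreal borel_measurable_RN_deriv)
  show "density \<mu> (\<lambda>x. RN d (x \<boxplus> d') * RN d' x) = translate \<mu> (d \<boxplus> d')"
  proof (rule measure_eqI)
    show "sets (density \<mu> (\<lambda>x. RN d (x \<boxplus> d') * RN d' x)) = sets (translate \<mu> (d \<boxplus> d'))"
      using sets_eq by (simp add: translate_def)
    fix A assume "A \<in> sets (density \<mu> (\<lambda>x. RN d (x \<boxplus> d') * RN d' x))"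
    then have A: "A \<in> sets \<mu>" by simp
    then have ind: "indicator A \<in> borel_measurable \<mu>" by simp
    then have ind': "(\<lambda>x. indicator A (x \<boxplus> d')) \<in> borel_measurable \<mu>"
      by (rule measurable_compose[OF measurable_translation])
    have "emeasure (density \<mu> (\<lambda>x. RN d (x \<boxplus> d') * RN d' x)) A
        = (\<integral>\<^sup>+x. RN d' x * (RN d (x \<boxplus> d') * indicator A x) \<partial>\<mu>)"
      using meas A by (simp add: emeasure_density mult_ac)
    also have "\<dots> = (\<integral>\<^sup>+x. RN d ((x \<boxplus> d') \<boxplus> d') * indicator A (x \<boxplus> d') \<partial>\<mu>)"
      \<comment> \<open>The change of variables is read from right to left, so \<open>RN d\<close>
        gets a second shift by \<open>d'\<close>, and the two shifts cancel.\<close>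
      by (rule nn_integral_translate_borel[symmetric, OF d' borel_measurable_times_ennreal[OF RNt ind]])
    also have "\<dots> = (\<integral>\<^sup>+x. RN d x * indicator A (x \<boxplus> d') \<partial>\<mu>)"
      by simp
    also have "\<dots> = (\<integral>\<^sup>+x. indicator A ((x \<boxplus> d) \<boxplus> d') \<partial>\<mu>)"
      by (rule nn_integral_translate_borel[symmetric, OF d ind'])
    also have "\<dots> = (\<integral>\<^sup>+x. indicator A (x \<boxplus> (d \<boxplus> d')) \<partial>\<mu>)"
      by (simp only: seq_add_assoc)
    also have "\<dots> = (\<integral>\<^sup>+x. indicator A x \<partial>translate \<mu> (d \<boxplus> d'))"
      using A sets_eq unfolding translate_def
      by (subst nn_integral_distr[OF measurable_translation_borel]) auto
    also have "\<dots> = emeasure (translate \<mu> (d \<boxplus> d')) A"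
      using A sets_eq by (simp add: translate_def)
    finally show "emeasure (density \<mu> (\<lambda>x. RN d (x \<boxplus> d') * RN d' x)) A = emeasure (translate \<mu> (d \<boxplus> d')) A" .
  qed
qed

text \<open>Every sequence is its own inverse, so this is translation by zero; the form
  \<open>d \<boxplus> d\<close> matches the cocycle identity with both shifts equal to
  \<open>d\<close>.\<close>

lemma RN_zero: "AE x in \<mu>. 1 = RN (d \<boxplus> d) x"
proof (rule RN_deriv_unique)
  have "translate \<mu> (d \<boxplus> d) = distr \<mu> \<mu> (\<lambda>x. x)"
    unfolding translate_def using sets_eq by (intro distr_cong) (auto simp flip: seq_add_assoc)
  then show "density \<mu> (\<lambda>_. 1) = translate \<mu> (d \<boxplus> d)"
    by (simp add: density_1)
qed simp

lemma RN_inverse: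
  assumes "quasi_invariant d"
  shows "AE x in \<mu>. RN d (x \<boxplus> d) * RN d x = 1"
  using RN_cocycle[OF assms assms] RN_zero[of d] by eventually_elim simp

text \<open>An infinite factor would make the product in \<open>RN_inverse\<close> 0 or
  \<open>top\<close>, never 1. Finiteness matters because \<open>sqrt_deriv\<close> passes through
  \<open>enn2real\<close>, which sends \<open>top\<close> to 0.\<close>

lemma RN_finite:
  assumes "quasi_invariant d"
  shows "AE x in \<mu>. RN d x \<noteq> top"
  using RN_inverse[OF assms] by eventually_elim (auto simp: ennreal_mult_top split: if_splits)

lemma sqrt_deriv_inverse:
  assumes "quasi_invariant d"
  shows "AE x in \<mu>. sqrt_deriv \<mu> d x * sqrt_deriv \<mu> d (x \<boxplus> d) = 1"
  using RN_inverse[OF assms]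
proof eventually_elim
  case (elim x)
  then have "enn2real (RN d (x \<boxplus> d)) * enn2real (RN d x) = 1"
    by (metis enn2real_mult enn2real_1)
  then show ?case
    by (simp add: sqrt_deriv_def mult.commute flip: real_sqrt_mult)
qed

text \<open>Both sides come from the derivative for the combined shift, which does not depend on the
  order of the shifts. This equates the weights of Q J_k and J_k Q.\<close>

lemma sqrt_deriv_commute:
  assumes "quasi_invariant d" and "quasi_invariant d'"
  shows "AE x in \<mu>. sqrt_deriv \<mu> d (x \<boxplus> d') * sqrt_deriv \<mu> d' x =
    sqrt_deriv \<mu> d' (x \<boxplus> d) * sqrt_deriv \<mu> d x"
  using RN_cocycle[OF assms] RN_cocycle[OF assms(2,1)]
proof eventually_elim
  case (elim x)
  then have "RN d (x \<boxplus> d') * RN d' x = RN d' (x \<boxplus> d) * RN d x"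
    by (simp add: seq_add_commute)
  then have "enn2real (RN d (x \<boxplus> d')) * enn2real (RN d' x) = enn2real (RN d' (x \<boxplus> d)) * enn2real (RN d x)"
    by (metis enn2real_mult)
  then show ?case
    by (simp add: sqrt_deriv_def flip: real_sqrt_mult)
qed

lemma sqrt_deriv_measurable: "sqrt_deriv \<mu> d \<in> borel_measurable (completion \<mu>)"
  unfolding sqrt_deriv_def by (intro measurable_completion) simp

lemma ennreal_sqrt_deriv_power2:
  assumes "quasi_invariant d"
  shows "AE x in \<mu>. ennreal ((sqrt_deriv \<mu> d x)\<^sup>2) = RN d x"
  using RN_finite[OF assms]
  by eventually_elim (simp add: sqrt_deriv_def less_top[symmetric])

lemma phase_measurable:
  "(\<lambda>x. (-1) ^ (\<Sum>j\<in>J. coord j x) :: complex) \<in> borel_measurable (completion \<mu>)"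
proof (rule measurable_completion)
  have "coord j \<in> measurable \<mu> (count_space UNIV)" for j
    unfolding coord_def measurable_cong_sets[OF sets_eq refl]
    using measurable_coordinate by (rule measurable_compose) simp
  then have "(\<lambda>x. \<Sum>j\<in>J. coord j x) \<in> measurable \<mu> (count_space UNIV)"
    by measurable
  then show "(\<lambda>x. (-1) ^ (\<Sum>j\<in>J. coord j x) :: complex) \<in> borel_measurable \<mu>"
    by (rule measurable_compose) simp
qed

end

section \<open>Operators on the direct integral\<close>

lemma cscale_add: "cscale z (v + w) = cscale z v + cscale z w"
  by (simp add: cscale_def scaleR_add_right)

lemma cscale_cscale: "cscale z (cscale w v) = cscale (z * w) v"
  by (simp add: cscale_def algebra_simps)

lemma cscale_of_real: "cscale (of_real r) v = r *\<^sub>R v"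
  by (simp add: cscale_def prod_eq_iff)

lemma conj_vec_cscale: "conj_vec (cscale z v) = cscale (cnj z) (conj_vec v)"
  by (simp add: cscale_def conj_vec_def)

lemma conj_vec_add: "conj_vec (v + w) = conj_vec v + conj_vec w"
  by (simp add: conj_vec_def)

lemma conj_vec_conj_vec [simp]: "conj_vec (conj_vec v) = v"
  by (simp add: conj_vec_def)

lemma norm_conj_vec [simp]: "norm (conj_vec v) = norm v"
  by (simp add: conj_vec_def norm_prod_def)

lemma norm_cscale:
  fixes v :: "'u::real_inner \<times> 'u"
  shows "norm (cscale z v) = cmod z * norm v"
proof -
  have "cscale z v \<bullet> cscale z v = (Re z * Re z + Im z * Im z) * (v \<bullet> v)"
    by (simp add: cscale_def inner_prod_def inner_add inner_diff inner_commute algebra_simps)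
  then have "(norm (cscale z v))\<^sup>2 = (cmod z * norm v)\<^sup>2"
    by (simp only: power2_norm_eq_inner[of "cscale z v"] power2_norm_eq_inner[of v] power_mult_distrib
        cmod_power2 power2_eq_square[of "Re z"] power2_eq_square[of "Im z"])
  then show ?thesis
    by (simp add: power2_eq_iff_nonneg)
qed

lemma cinner_self: "cinner v v = of_real ((norm v)\<^sup>2)"
  by (simp add: cinner_def norm_prod_def complex_eq_iff power2_norm_eq_inner inner_commute)

lemma unitary_on_norm:
  assumes "unitary_on S A" and "v \<in> S"
  shows "norm (A v) = norm v"
proof -
  have "cinner (A v) (A v) = cinner v v"
    using assms by (simp add: unitary_on_def)
  then have "(norm (A v))\<^sup>2 = (norm v)\<^sup>2"
    by (simp only: cinner_self of_real_eq_iff)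
  then show ?thesis by (simp add: power2_eq_iff_nonneg)
qed

locale real_family = binseq_measure +
  fixes U :: "binseq \<Rightarrow> 'u::{real_inner,complete_space} set" and e :: "nat \<Rightarrow> binseq \<Rightarrow> 'u"
  assumes fam: "real_measurable_family \<mu> U e"
begin

abbreviation V :: "binseq \<Rightarrow> ('u \<times> 'u) set"
  where "V \<equiv> complexify_family U"

abbreviation eV :: "nat \<Rightarrow> binseq \<Rightarrow> 'u \<times> 'u"
  where "eV \<equiv> complexify_sections e"

lemma conj_vec_mem:
  assumes "v \<in> V x"
  shows "conj_vec v \<in> V x"
  using assms fam
  by (auto simp: complexify_family_def conj_vec_def real_measurable_family_def intro: subspace_neg)

text \<open>The fundamental sections \<open>eV n\<close> have zero imaginary part, so the real and
  imaginary parts of the complex inner product are the inner products of the two components. All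
  facts on complex sections are thereby inherited from real ones.\<close>

lemma measurable_section_iff:
  "measurable_section \<mu> V eV f \<longleftrightarrow>
    real_measurable_section \<mu> U e (\<lambda>x. fst (f x)) \<and> real_measurable_section \<mu> U e (\<lambda>x. snd (f x))"
proof -
  have V: "f x \<in> V x \<longleftrightarrow> fst (f x) \<in> U x \<and> snd (f x) \<in> U x" for x
    by (simp add: complexify_family_def mem_Times_iff)
  have "cinner (f x) (eV n x) = Complex (fst (f x) \<bullet> e n x) (snd (f x) \<bullet> e n x)" for n x
    by (simp add: cinner_def complexify_sections_def)
  then have "(\<lambda>x. cinner (f x) (eV n x)) \<in> borel_measurable (completion \<mu>) \<longleftrightarrow>
      (\<lambda>x. fst (f x) \<bullet> e n x) \<in> borel_measurable (completion \<mu>) \<and>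
      (\<lambda>x. snd (f x) \<bullet> e n x) \<in> borel_measurable (completion \<mu>)" for n
    by (simp add: borel_measurable_complex_iff)
  with V show ?thesis
    by (auto simp: measurable_section_def real_measurable_section_def)
qed

text \<open>The inner product of the translate with \<open>e n\<close> is the translate of the inner
  product of \<open>f\<close> with a translated \<open>e n\<close>. The latter is an inner product
  of two measurable sections.\<close>

lemma real_measurable_section_translate:
  assumes d: "quasi_invariant d" and inv: "real_translation_invariant \<mu> U e d"
    and f: "real_measurable_section \<mu> U e f"
  shows "real_measurable_section \<mu> U e (\<lambda>x. f (x \<boxplus> d))"
  unfolding real_measurable_section_def
proof safe
  have "AE x in \<mu>. U (x \<boxplus> d) = U x" "AE x in \<mu>. f x \<in> U x"
    using inv f by (simp_all add: real_translation_invariant_def real_measurable_section_def)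
  from this(1) AE_translate[OF d this(2)] show "AE x in \<mu>. f (x \<boxplus> d) \<in> U x"
    by eventually_elim simp
  fix n
  have "real_measurable_section \<mu> U e (\<lambda>x. e n (x \<boxplus> d))"
    using inv by (simp add: real_translation_invariant_def)
  with f have "(\<lambda>x. f x \<bullet> e n (x \<boxplus> d)) \<in> borel_measurable (completion \<mu>)"
    by (rule inner_measurable_sections[OF fam])
  then have "(\<lambda>x. f (x \<boxplus> d) \<bullet> e n ((x \<boxplus> d) \<boxplus> d)) \<in> borel_measurable (completion \<mu>)"
    by (rule measurable_compose[OF measurable_completion_translation[OF d]])
  then show "(\<lambda>x. f (x \<boxplus> d) \<bullet> e n x) \<in> borel_measurable (completion \<mu>)"
    by simp
qed

lemma measurable_section_translate:
  assumes "quasi_invariant d" and "real_translation_invariant \<mu> U e d"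
    and "measurable_section \<mu> V eV f"
  shows "measurable_section \<mu> V eV (\<lambda>x. f (x \<boxplus> d))"
  using assms by (auto simp: measurable_section_iff intro: real_measurable_section_translate)

lemma measurable_section_add:
  assumes "measurable_section \<mu> V eV f" and "measurable_section \<mu> V eV g"
  shows "measurable_section \<mu> V eV (\<lambda>x. f x + g x)"
  using assms by (auto simp: measurable_section_iff intro: real_measurable_section_add[OF fam])

lemma measurable_section_cscale:
  assumes "measurable_section \<mu> V eV f" and "z \<in> borel_measurable (completion \<mu>)"
  shows "measurable_section \<mu> V eV (\<lambda>x. cscale (z x) (f x))"
proof -
  have "(\<lambda>x. Re (z x)) \<in> borel_measurable (completion \<mu>)" "(\<lambda>x. Im (z x)) \<in> borel_measurable (completion \<mu>)"
    using assms(2) by (simp_all add: borel_measurable_complex_iff)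
  with assms(1) show ?thesis
    by (auto simp: measurable_section_iff cscale_def
        intro!: real_measurable_section_add[OF fam] real_measurable_section_diff[OF fam]
          real_measurable_section_scaleR[OF fam])
qed

lemma measurable_section_conj_vec:
  assumes "measurable_section \<mu> V eV f"
  shows "measurable_section \<mu> V eV (\<lambda>x. conj_vec (f x))"
  using assms real_measurable_section_scaleR[OF fam, of "\<lambda>x. snd (f x)" "\<lambda>_. -1"]
  by (simp add: measurable_section_iff conj_vec_def)

lemma norm_measurable_section_complex:
  assumes "measurable_section \<mu> V eV f"
  shows "(\<lambda>x. norm (f x)) \<in> borel_measurable (completion \<mu>)"
proof -
  have "(\<lambda>x. sqrt ((norm (fst (f x)))\<^sup>2 + (norm (snd (f x)))\<^sup>2)) \<in> borel_measurable (completion \<mu>)"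
    using assms unfolding measurable_section_iff
    by (intro measurable_compose[OF _ borel_measurable_sqrt] borel_measurable_add borel_measurable_power norm_measurable_section[OF fam]) auto
  then show ?thesis
    by (simp add: norm_prod_def)
qed

section \<open>Square-integrable sections and weighted shifts\<close>

abbreviation L2 :: "(binseq \<Rightarrow> 'u \<times> 'u) set"
  where "L2 \<equiv> L2_sections \<mu> V eV"

text \<open>Stated with the nonnegative integral over \<open>\<mu>\<close>, so that the change of
  variables with extended nonnegative densities applies directly.\<close>

lemma L2_iff:
  "f \<in> L2 \<longleftrightarrow> measurable_section \<mu> V eV f \<and> (\<integral>\<^sup>+x. ennreal ((norm (f x))\<^sup>2) \<partial>\<mu>) < \<infinity>"
proof -
  have "integrable (completion \<mu>) (\<lambda>x. (norm (f x))\<^sup>2) \<longleftrightarrow> (\<integral>\<^sup>+x. ennreal ((norm (f x))\<^sup>2) \<partial>\<mu>) < \<infinity>"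
    if "measurable_section \<mu> V eV f"
    using borel_measurable_power[OF norm_measurable_section_complex[OF that], of 2]
    by (simp add: integrable_iff_bounded nn_integral_completion)
  then show ?thesis
    by (auto simp: L2_sections_def)
qed

lemma L2_integral:
  assumes "f \<in> L2"
  shows "(LINT x|completion \<mu>. (norm (f x))\<^sup>2) = enn2real (\<integral>\<^sup>+x. ennreal ((norm (f x))\<^sup>2) \<partial>\<mu>)"
  using assms borel_measurable_power[OF norm_measurable_section_complex[of f], of 2]
  by (simp add: integral_eq_nn_integral nn_integral_completion L2_iff)

lemma L2_add:
  assumes "f \<in> L2" and "g \<in> L2"
  shows "(\<lambda>x. f x + g x) \<in> L2"
proof -
  have sec: "measurable_section \<mu> V eV (\<lambda>x. f x + g x)"
    using assms by (auto simp: L2_sections_def intro: measurable_section_add)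
  have le: "(norm (v + w))\<^sup>2 \<le> 2 * (norm v)\<^sup>2 + 2 * (norm w)\<^sup>2" for v w :: "'u \<times> 'u"
  proof -
    have "(norm (v + w))\<^sup>2 \<le> (norm v + norm w)\<^sup>2"
      by (intro power_mono norm_triangle_ineq) simp
    also have "\<dots> \<le> 2 * (norm v)\<^sup>2 + 2 * (norm w)\<^sup>2"
      using zero_le_power2[of "norm v - norm w"] by (simp add: power2_eq_square algebra_simps)
    finally show ?thesis .
  qed
  have "integrable (completion \<mu>) (\<lambda>x. 2 * (norm (f x))\<^sup>2 + 2 * (norm (g x))\<^sup>2)"
    using assms by (auto simp: L2_sections_def)
  then have "integrable (completion \<mu>) (\<lambda>x. (norm (f x + g x))\<^sup>2)"
    by (rule Bochner_Integration.integrable_bound)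
      (auto intro!: borel_measurable_power norm_measurable_section_complex sec AE_I2 order_trans[OF le])
  with sec show ?thesis
    by (simp add: L2_sections_def)
qed

lemma L2_cscale:
  assumes "f \<in> L2"
  shows "(\<lambda>x. cscale z (f x)) \<in> L2"
  using assms by (auto simp: L2_sections_def norm_cscale power_mult_distrib intro: measurable_section_cscale)

text \<open>The operators \<open>J\<close>, \<open>J'\<close> and \<open>Q\<close> are all of this form, with \<open>z\<close> of modulus one.\<close>

definition weighted_shift ::
    "binseq \<Rightarrow> (binseq \<Rightarrow> complex) \<Rightarrow> (binseq \<Rightarrow> 'u \<times> 'u \<Rightarrow> 'u \<times> 'u) \<Rightarrow> (binseq \<Rightarrow> 'u \<times> 'u) \<Rightarrow> binseq \<Rightarrow> 'u \<times> 'u"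
  where "weighted_shift d z B f x = cscale (z x * of_real (sqrt_deriv \<mu> d x)) (B x (f (x \<boxplus> d)))"

lemma weighted_shift_cong:
  assumes "quasi_invariant d" and "AE x in \<mu>. f x = g x"
  shows "AE x in \<mu>. weighted_shift d z B f x = weighted_shift d z B g x"
  using AE_translate[OF assms] by eventually_elim (simp add: weighted_shift_def)

text \<open>The squared weight is the density that undoes the translation of the integrand. No
  linearity of \<open>B\<close> enters, so the antilinear \<open>conj_vec\<close> and the unitary
  \<open>c k\<close> are treated alike.\<close>

lemma weighted_shift_isometry:
  assumes d: "quasi_invariant d" and inv: "real_translation_invariant \<mu> U e d"
    and z: "z \<in> borel_measurable (completion \<mu>)" "\<And>x. cmod (z x) = 1"
    and B: "\<And>f. measurable_section \<mu> V eV f \<Longrightarrow> measurable_section \<mu> V eV (\<lambda>x. B x (f x))"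
      "AE x in \<mu>. \<forall>v\<in>V x. norm (B x v) = norm v"
    and f: "f \<in> L2"
  shows "weighted_shift d z B f \<in> L2"
    and "(LINT x|completion \<mu>. (norm (weighted_shift d z B f x))\<^sup>2) = (LINT x|completion \<mu>. (norm (f x))\<^sup>2)"
proof -
  have f': "measurable_section \<mu> V eV f"
    using f by (simp add: L2_iff)
  note ft = measurable_section_translate[OF d inv f']
  have sec: "measurable_section \<mu> V eV (weighted_shift d z B f)"
    unfolding weighted_shift_def
    using z(1) sqrt_deriv_measurable
    by (intro measurable_section_cscale B(1) ft borel_measurable_times measurable_compose[OF _ borel_measurable_of_real])
  have "AE x in \<mu>. f (x \<boxplus> d) \<in> V x"
    using ft by (simp add: measurable_section_def)
  with B(2) ennreal_sqrt_deriv_power2[OF d]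
  have "AE x in \<mu>. ennreal ((norm (weighted_shift d z B f x))\<^sup>2) = RN d x * ennreal ((norm (f (x \<boxplus> d)))\<^sup>2)"
  proof eventually_elim
    case (elim x)
    then have "(norm (weighted_shift d z B f x))\<^sup>2 = (sqrt_deriv \<mu> d x)\<^sup>2 * (norm (f (x \<boxplus> d)))\<^sup>2"
      by (simp add: weighted_shift_def norm_cscale norm_mult z(2) power_mult_distrib)
    with elim(2) show ?case
      by (simp add: ennreal_mult)
  qed
  then have "(\<integral>\<^sup>+x. ennreal ((norm (weighted_shift d z B f x))\<^sup>2) \<partial>\<mu>)
      = (\<integral>\<^sup>+x. RN d x * ennreal ((norm (f (x \<boxplus> d)))\<^sup>2) \<partial>\<mu>)"
    by (rule nn_integral_cong_AE)
  \<comment> \<open>The change of variables is applied to the already translated integrand, so the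
    second shift by \<open>d\<close> restores f(x).\<close>
  also have "\<dots> = (\<integral>\<^sup>+x. ennreal ((norm (f ((x \<boxplus> d) \<boxplus> d)))\<^sup>2) \<partial>\<mu>)"
    using borel_measurable_power[OF norm_measurable_section_complex[OF ft], of 2]
    by (intro nn_integral_translate[symmetric, OF d] measurable_compose[OF _ measurable_ennreal])
  finally have eq: "(\<integral>\<^sup>+x. ennreal ((norm (weighted_shift d z B f x))\<^sup>2) \<partial>\<mu>)
      = (\<integral>\<^sup>+x. ennreal ((norm (f x))\<^sup>2) \<partial>\<mu>)"
    by simp
  with sec f show *: "weighted_shift d z B f \<in> L2"
    by (simp add: L2_iff)
  show "(LINT x|completion \<mu>. (norm (weighted_shift d z B f x))\<^sup>2) = (LINT x|completion \<mu>. (norm (f x))\<^sup>2)"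
    using eq by (simp add: L2_integral[OF *] L2_integral[OF f])
qed

section \<open>Classes of sections modulo equality almost everywhere\<close>

definition cls :: "(binseq \<Rightarrow> 'u \<times> 'u) \<Rightarrow> (binseq \<Rightarrow> 'u \<times> 'u) set"
  where "cls f = section_eq \<mu> V eV `` {f}"

text \<open>The membership of \<open>f\<close> itself is part of the condition: \<open>cls f\<close>
  is empty for \<open>f\<close> outside \<open>L2\<close>.\<close>

lemma mem_cls: "g \<in> cls f \<longleftrightarrow> f \<in> L2 \<and> g \<in> L2 \<and> (AE x in \<mu>. f x = g x)"
  by (simp add: cls_def section_eq_def)

lemma cls_eqI:
  assumes "f \<in> L2" and "g \<in> L2" and "AE x in \<mu>. f x = g x"
  shows "cls f = cls g"
proof -
  have *: "AE x in \<mu>. f x = h x" if "AE x in \<mu>. g x = h x" for h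
    using assms(3) that by eventually_elim simp
  have "AE x in \<mu>. g x = h x" if "AE x in \<mu>. f x = h x" for h
    using assms(3) that by eventually_elim simp
  with * assms(1,2) show ?thesis
    by (auto simp: mem_cls)
qed

lemma direct_integral_eq: "direct_integral \<mu> V eV = cls ` L2"
  by (auto simp: direct_integral_def quotient_def cls_def)

text \<open>\<open>lift_op\<close> and \<open>dint_add\<close> saturate a whole set of sections. If
  its members are equal almost everywhere, they all generate one class, and \<open>h\<close>
  witnesses that the set is not empty.\<close>

lemma section_eq_Image_eq:
  assumes "h \<in> X" and "\<And>g. g \<in> X \<Longrightarrow> h \<in> L2 \<and> g \<in> L2 \<and> (AE x in \<mu>. h x = g x)"
  shows "section_eq \<mu> V eV `` X = cls h"
proof -
  have "cls g = cls h" if "g \<in> X" for g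
    using assms(2)[OF that] by (intro cls_eqI[symmetric]) auto
  then have "(\<Union>g\<in>X. cls g) = (\<Union>g\<in>X. cls h)"
    by (intro SUP_cong refl)
  moreover have "section_eq \<mu> V eV `` X = (\<Union>g\<in>X. cls g)"
    by (auto simp: cls_def)
  moreover have "X \<noteq> {}"
    using assms(1) by blast
  ultimately show ?thesis
    by (simp only: SUP_constant if_False)
qed

text \<open>The first two assumptions say that \<open>T\<close> is well defined on classes. The
  image of a class need not be a full class, but saturation completes it.\<close>

lemma lift_op_cls:
  assumes "\<And>f. f \<in> L2 \<Longrightarrow> T f \<in> L2"
    and "\<And>f g. AE x in \<mu>. f x = g x \<Longrightarrow> AE x in \<mu>. T f x = T g x"
    and "f \<in> L2"
  shows "lift_op \<mu> V eV T (cls f) = cls (T f)"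
  unfolding lift_op_def
proof (rule section_eq_Image_eq)
  have "f \<in> cls f"
    using assms(3) by (simp add: mem_cls)
  then show "T f \<in> T ` cls f"
    by (rule imageI)
  fix g assume "g \<in> T ` cls f"
  then show "T f \<in> L2 \<and> g \<in> L2 \<and> (AE x in \<mu>. T f x = g x)"
    using assms by (auto simp: mem_cls)
qed

lemma dint_scale_cls:
  assumes "f \<in> L2"
  shows "dint_scale \<mu> V eV z (cls f) = cls (\<lambda>x. cscale z (f x))"
  unfolding dint_scale_def
proof (rule lift_op_cls[OF _ _ assms])
  show "AE x in \<mu>. cscale z (f x) = cscale z (g x)" if "AE x in \<mu>. f x = g x"
    for f g :: "binseq \<Rightarrow> 'u \<times> 'u"
    using that by eventually_elim simp
qed (rule L2_cscale)

lemma dint_add_cls: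
  assumes "f \<in> L2" and "g \<in> L2"
  shows "dint_add \<mu> V eV (cls f) (cls g) = cls (\<lambda>x. f x + g x)"
  unfolding dint_add_def
proof (rule section_eq_Image_eq)
  have "f \<in> cls f" "g \<in> cls g"
    using assms by (simp_all add: mem_cls)
  then show "(\<lambda>x. f x + g x) \<in> {(\<lambda>x. f' x + g' x) | f' g'. f' \<in> cls f \<and> g' \<in> cls g}"
    by blast
next
  fix h assume "h \<in> {(\<lambda>x. f' x + g' x) | f' g'. f' \<in> cls f \<and> g' \<in> cls g}"
  then obtain f' g' where h: "h = (\<lambda>x. f' x + g' x)" and mem: "f' \<in> cls f" "g' \<in> cls g"
    by blast
  then have "AE x in \<mu>. f x = f' x" "AE x in \<mu>. g x = g' x"
    by (simp_all add: mem_cls)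
  then have "AE x in \<mu>. f x + g x = h x"
    unfolding h by eventually_elim simp
  with mem show "(\<lambda>x. f x + g x) \<in> L2 \<and> h \<in> L2 \<and> (AE x in \<mu>. f x + g x = h x)"
    by (simp add: h mem_cls L2_add)
qed

text \<open>The definite description is legitimate: the integral is constant on the class, and the
  class contains \<open>f\<close>, which forces the value.\<close>

lemma dint_norm_cls:
  assumes "f \<in> L2"
  shows "dint_norm \<mu> (cls f) = sqrt (LINT x|completion \<mu>. (norm (f x))\<^sup>2)"
  unfolding dint_norm_def
proof (rule the_equality)
  show "\<forall>g\<in>cls f. sqrt (LINT x|completion \<mu>. (norm (f x))\<^sup>2) = sqrt (LINT x|completion \<mu>. (norm (g x))\<^sup>2)"
  proof
    fix g assume g: "g \<in> cls f"
    then have "AE x in \<mu>. f x = g x"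
      by (simp add: mem_cls)
    then have "AE x in \<mu>. ennreal ((norm (f x))\<^sup>2) = ennreal ((norm (g x))\<^sup>2)"
      by eventually_elim simp
    then have "(\<integral>\<^sup>+x. ennreal ((norm (f x))\<^sup>2) \<partial>\<mu>) = (\<integral>\<^sup>+x. ennreal ((norm (g x))\<^sup>2) \<partial>\<mu>)"
      by (rule nn_integral_cong_AE)
    with assms g show "sqrt (LINT x|completion \<mu>. (norm (f x))\<^sup>2) = sqrt (LINT x|completion \<mu>. (norm (g x))\<^sup>2)"
      by (simp add: L2_integral mem_cls)
  qed
  fix r assume "\<forall>g\<in>cls f. r = sqrt (LINT x|completion \<mu>. (norm (g x))\<^sup>2)"
  then show "r = sqrt (LINT x|completion \<mu>. (norm (f x))\<^sup>2)"
    using assms by (simp add: mem_cls)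
qed

end

section \<open>The quaternionic structure\<close>

lemma phase_ones:
  assumes "finite J"
  shows "(-1) ^ (\<Sum>j\<in>J. coord j (x \<boxplus> ones)) = (-1) ^ card J * ((-1) ^ (\<Sum>j\<in>J. coord j x) :: complex)"
proof -
  have "(-1) ^ coord j (x \<boxplus> ones) = - ((-1) ^ coord j x :: complex)" for j
    by (simp add: coord_def seq_add_def ones_def)
  then show ?thesis
    by (simp add: power_sum prod_uminus)
qed

text \<open>Source of the exceptional case k = 1 in the conjugation rule. The bound on
  \<open>k\<close> excludes 0, where truncated subtraction would make \<open>unit_seq 0\<close>
  equal to \<open>unit_seq 1\<close>.\<close>

lemma phase_unit_seq:
  assumes "1 \<le> k"
  shows "(-1) ^ coord 1 (x \<boxplus> unit_seq k) = (if k = 1 then - 1 else 1) * ((-1) ^ coord 1 x :: complex)"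
  using assms by (auto simp: coord_def seq_add_def unit_seq_def)

lemma unit_seq_fin: "unit_seq k \<in> fin_seqs"
  by (simp add: fin_seqs_def unit_seq_def)

locale quaternionic_GW = real_family \<mu> U e
  for \<mu> and U :: "binseq \<Rightarrow> 'u::{real_inner,complete_space} set" and e +
  fixes \<nu> :: "binseq \<Rightarrow> enat" and c :: "nat \<Rightarrow> binseq \<Rightarrow> 'u \<times> 'u \<Rightarrow> 'u \<times> 'u"
  assumes inv_fin: "\<And>d. d \<in> fin_seqs \<Longrightarrow> real_translation_invariant \<mu> U e d"
    and inv_ones: "real_translation_invariant \<mu> U e ones"
    and triple: "GW_triple \<mu> V eV \<nu> c"
    and quasi_ones: "quasi_invariant ones"
    and conj_1: "AE x in \<mu>. \<forall>v\<in>V x. conj_op (c 1 x) v = c 1 (flip x) v"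
    and conj_ge_2: "\<And>k. 2 \<le> k \<Longrightarrow> AE x in \<mu>. \<forall>v\<in>V x. conj_op (c k x) v = (-1) ^ k *\<^sub>R c k (flip x) v"
begin

text \<open>Merges the two conjugation rules; the formula for k \<ge> 2 would give the wrong sign at
  k = 1.\<close>

definition conj_sign :: "nat \<Rightarrow> real"
  where "conj_sign k = (if k = 1 then 1 else (-1) ^ k)"

lemma conj_c:
  assumes "1 \<le> k"
  shows "AE x in \<mu>. \<forall>v\<in>V x. conj_op (c k x) v = conj_sign k *\<^sub>R c k (flip x) v"
proof (cases "k = 1")
  case True
  then show ?thesis
    using conj_1 by (simp add: conj_sign_def)
next
  case False
  with assms have "2 \<le> k" by linarith
  with conj_ge_2[OF this] show ?thesis
    by (simp add: conj_sign_def)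
qed

lemma quasi_unit: "quasi_invariant (unit_seq k)"
  using triple unit_seq_fin by (simp add: GW_triple_def)

lemma unitary_c: "1 \<le> k \<Longrightarrow> AE x in \<mu>. unitary_on (V x) (c k x)"
  using triple by (simp add: GW_triple_def)

lemma measurable_section_c:
  "1 \<le> k \<Longrightarrow> measurable_section \<mu> V eV f \<Longrightarrow> measurable_section \<mu> V eV (\<lambda>x. c k x (f x))"
  using triple by (simp add: GW_triple_def)

definition Q :: "(binseq \<Rightarrow> 'u \<times> 'u) \<Rightarrow> binseq \<Rightarrow> 'u \<times> 'u"
  where "Q = weighted_shift ones (\<lambda>x. (-1) ^ coord 1 x) (\<lambda>_. conj_vec)"

lemma Q_section_eq: "Q_section \<mu> = Q"
  by (intro ext) (simp add: Q_def Q_section_def weighted_shift_def flip_def)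

lemma Q_isometry:
  assumes "f \<in> L2"
  shows "Q f \<in> L2"
    and "(LINT x|completion \<mu>. (norm (Q f x))\<^sup>2) = (LINT x|completion \<mu>. (norm (f x))\<^sup>2)"
proof -
  have "(\<lambda>x. (-1) ^ coord 1 x :: complex) \<in> borel_measurable (completion \<mu>)"
    using phase_measurable[of "{1}"] by simp
  note * = quasi_ones inv_ones this _ measurable_section_conj_vec _ assms
  show "Q f \<in> L2"
    unfolding Q_def by (rule weighted_shift_isometry(1)[OF *]) (simp_all add: norm_power)
  show "(LINT x|completion \<mu>. (norm (Q f x))\<^sup>2) = (LINT x|completion \<mu>. (norm (f x))\<^sup>2)"
    unfolding Q_def by (rule weighted_shift_isometry(2)[OF *]) (simp_all add: norm_power)
qed

lemma c_shift_L2: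
  assumes k: "1 \<le> k" and z: "z \<in> borel_measurable (completion \<mu>)" "\<And>x. cmod (z x) = 1"
    and f: "f \<in> L2"
  shows "weighted_shift (unit_seq k) z (c k) f \<in> L2"
proof (rule weighted_shift_isometry(1)[OF quasi_unit inv_fin[OF unit_seq_fin] z measurable_section_c[OF k] _ f])
  show "AE x in \<mu>. \<forall>v\<in>V x. norm (c k x v) = norm v"
    using unitary_c[OF k] by eventually_elim (simp add: unitary_on_norm)
qed

text \<open>Conjugation turns \<open>c k\<close> at the flipped point into \<open>c k\<close> at x
  up to \<open>conj_sign k\<close>, and the weights agree by \<open>sqrt_deriv_commute\<close>. What
  remains is the scalar condition on \<open>z\<close>, which covers \<open>J\<close> and
  \<open>J'\<close> at once.\<close>

lemma Q_c_shift_commute: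
  assumes k: "1 \<le> k" and f: "f \<in> L2"
    and z: "\<And>x. (-1) ^ coord 1 x * cnj (z (x \<boxplus> ones)) * of_real (conj_sign k)
      = z x * (-1) ^ coord 1 (x \<boxplus> unit_seq k)"
  shows "AE x in \<mu>. Q (weighted_shift (unit_seq k) z (c k) f) x
    = weighted_shift (unit_seq k) z (c k) (Q f) x"
proof -
  let ?s = "sqrt_deriv \<mu>" and ?d = "unit_seq k"
  have "AE x in \<mu>. f (x \<boxplus> ?d) \<in> V x"
    using measurable_section_translate[OF quasi_unit inv_fin[OF unit_seq_fin], of f] f
    by (simp add: L2_iff measurable_section_def)
  \<comment> \<open>Membership is needed in two fibres: the conjugation rule is applied at
    \<open>x \<boxplus> ones\<close>, while linearity of \<open>c k\<close> is used at
    \<open>x\<close>. They coincide by invariance under \<open>ones\<close>.\<close>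
  then have "AE x in \<mu>. f ((x \<boxplus> ones) \<boxplus> ?d) \<in> V (x \<boxplus> ones)"
    by (rule AE_translate[OF quasi_ones])
  moreover have "AE x in \<mu>. U (x \<boxplus> ones) = U x"
    using inv_ones by (simp add: real_translation_invariant_def)
  moreover note sqrt_deriv_commute[OF quasi_unit[of k] quasi_ones] unitary_c[OF k]
    AE_translate[OF quasi_ones conj_c[OF k]]
  ultimately show ?thesis
  proof eventually_elim
    case (elim x)
    define w where "w = f ((x \<boxplus> ones) \<boxplus> ?d)"
    have swap: "(x \<boxplus> ?d) \<boxplus> ones = (x \<boxplus> ones) \<boxplus> ?d"
      by (auto simp: seq_add_def)
    have w: "conj_vec w \<in> V (x \<boxplus> ones)"
      using elim(1) unfolding w_def by (rule conj_vec_mem)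
    then have wV: "conj_vec w \<in> V x"
      using elim(2) by (simp add: complexify_family_def)
    have "conj_vec (c k (x \<boxplus> ones) w) = conj_op (c k (x \<boxplus> ones)) (conj_vec w)"
      by (simp add: conj_op_def)
    \<comment> \<open>The rule is taken at \<open>x \<boxplus> ones\<close>, whose flip is
      \<open>x\<close> again.\<close>
    also have "\<dots> = cscale (of_real (conj_sign k)) (c k x (conj_vec w))"
      using elim(5) w by (simp add: flip_def cscale_of_real)
    finally have cw: "conj_vec (c k (x \<boxplus> ones) w) = cscale (of_real (conj_sign k)) (c k x (conj_vec w))" .
    have "Q (weighted_shift ?d z (c k) f) x =
        cscale ((-1) ^ coord 1 x * of_real (?s ones x) * (cnj (z (x \<boxplus> ones)) * of_real (?s ?d (x \<boxplus> ones)))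
          * of_real (conj_sign k)) (c k x (conj_vec w))"
      by (simp add: Q_def weighted_shift_def conj_vec_cscale cscale_cscale cw mult.assoc flip: w_def)
    also have "(-1) ^ coord 1 x * of_real (?s ones x) * (cnj (z (x \<boxplus> ones)) * of_real (?s ?d (x \<boxplus> ones)))
          * of_real (conj_sign k)
        = ((-1) ^ coord 1 x * cnj (z (x \<boxplus> ones)) * of_real (conj_sign k))
          * of_real (?s ?d (x \<boxplus> ones) * ?s ones x)"
      by (simp add: mult_ac)
    also have "\<dots> = z x * of_real (?s ?d x) * ((-1) ^ coord 1 (x \<boxplus> ?d) * of_real (?s ones (x \<boxplus> ?d)))"
      unfolding z elim(3) by (simp add: mult_ac)
    \<comment> \<open>Complex linearity of \<open>c k x\<close> moves the scalar of Q inside the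
      operator.\<close>
    also have "cscale \<dots> (c k x (conj_vec w)) = cscale (z x * of_real (?s ?d x))
        (c k x (cscale ((-1) ^ coord 1 (x \<boxplus> ?d) * of_real (?s ones (x \<boxplus> ?d))) (conj_vec w)))"
      using elim(4) wV by (simp add: unitary_on_def cscale_cscale)
    also have "\<dots> = weighted_shift ?d z (c k) (Q f) x"
      by (simp add: Q_def weighted_shift_def swap w_def)
    finally show ?case .
  qed
qed

text \<open>The phases at x and at its flip are opposite, the weights at the two points are mutually
  inverse, and the scalars are real, so the conjugations cancel without touching them.\<close>

lemma Q_Q:
  "AE x in \<mu>. Q (Q f) x = cscale (-1) (f x)"
  using sqrt_deriv_inverse[OF quasi_ones]
proof eventually_elim
  case (elim x)
  let ?s = "sqrt_deriv \<mu> ones"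
  have "Q (Q f) x = cscale ((-1) ^ coord 1 x * (-1) ^ coord 1 (x \<boxplus> ones)
      * of_real (?s x * ?s (x \<boxplus> ones))) (f x)"
    by (simp add: Q_def weighted_shift_def conj_vec_cscale cscale_cscale mult_ac)
  also have "(-1) ^ coord 1 x * (-1) ^ coord 1 (x \<boxplus> ones) * of_real (?s x * ?s (x \<boxplus> ones)) = (-1 :: complex)"
    unfolding elim using phase_ones[of "{1}" x] by (simp flip: power_add mult_2)
  finally show ?case .
qed

lemma lift_Q_cls: "f \<in> L2 \<Longrightarrow> lift_op \<mu> V eV Q (cls f) = cls (Q f)"
  by (rule lift_op_cls[OF Q_isometry(1)]) (simp_all only: Q_def weighted_shift_cong[OF quasi_ones])

lemma lift_Q_commute:
  assumes k: "1 \<le> k" and z: "z \<in> borel_measurable (completion \<mu>)" "\<And>x. cmod (z x) = 1"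
    and sign: "\<And>x. (-1) ^ coord 1 x * cnj (z (x \<boxplus> ones)) * of_real (conj_sign k)
      = z x * (-1) ^ coord 1 (x \<boxplus> unit_seq k)"
    and T: "T = weighted_shift (unit_seq k) z (c k)"
    and A: "A \<in> direct_integral \<mu> V eV"
  shows "lift_op \<mu> V eV Q (lift_op \<mu> V eV T A) = lift_op \<mu> V eV T (lift_op \<mu> V eV Q A)"
proof -
  obtain f where f: "f \<in> L2" and A: "A = cls f"
    using A by (auto simp: direct_integral_eq)
  note T_L2 = c_shift_L2[OF k z]
  note lift_T = lift_op_cls[OF T_L2 weighted_shift_cong[OF quasi_unit]]
  have "cls (Q (T f)) = cls (T (Q f))"
    unfolding T using f Q_c_shift_commute[OF k f sign]
    by (intro cls_eqI Q_isometry(1) T_L2)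
  then show ?thesis
    unfolding A T using f by (simp add: lift_T lift_Q_cls T_L2 Q_isometry(1))
qed

lemma invariant_quaternionic_structure_Q:
  "invariant_quaternionic_structure \<mu> V eV c (lift_op \<mu> V eV Q)"
  unfolding invariant_quaternionic_structure_def
proof (intro conjI ballI allI impI)
  show "lift_op \<mu> V eV Q \<in> direct_integral \<mu> V eV \<rightarrow> direct_integral \<mu> V eV"
    by (auto simp: direct_integral_eq lift_Q_cls Q_isometry(1))
next
  fix A B assume "A \<in> direct_integral \<mu> V eV" "B \<in> direct_integral \<mu> V eV"
  then obtain f g where f: "f \<in> L2" "A = cls f" and g: "g \<in> L2" "B = cls g"
    by (auto simp: direct_integral_eq)
  have "Q (\<lambda>x. f x + g x) = (\<lambda>x. Q f x + Q g x)"
    by (simp add: Q_def weighted_shift_def fun_eq_iff cscale_add conj_vec_add)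
  with f g show "lift_op \<mu> V eV Q (dint_add \<mu> V eV A B)
      = dint_add \<mu> V eV (lift_op \<mu> V eV Q A) (lift_op \<mu> V eV Q B)"
    by (simp add: dint_add_cls lift_Q_cls L2_add Q_isometry(1))
next
  fix z A assume "A \<in> direct_integral \<mu> V eV"
  then obtain f where f: "f \<in> L2" "A = cls f"
    by (auto simp: direct_integral_eq)
  have "Q (\<lambda>x. cscale z (f x)) = (\<lambda>x. cscale (cnj z) (Q f x))"
    by (simp add: Q_def weighted_shift_def fun_eq_iff conj_vec_cscale cscale_cscale mult_ac)
  with f show "lift_op \<mu> V eV Q (dint_scale \<mu> V eV z A) = dint_scale \<mu> V eV (cnj z) (lift_op \<mu> V eV Q A)"
    by (simp add: dint_scale_cls lift_Q_cls L2_cscale Q_isometry(1))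
next
  fix A assume "A \<in> direct_integral \<mu> V eV"
  then obtain f where f: "f \<in> L2" "A = cls f"
    by (auto simp: direct_integral_eq)
  then show "dint_norm \<mu> (lift_op \<mu> V eV Q A) = dint_norm \<mu> A"
    by (simp add: lift_Q_cls dint_norm_cls Q_isometry)
  have "cls (Q (Q f)) = cls (\<lambda>x. cscale (-1) (f x))"
    using f(1) by (intro cls_eqI Q_Q Q_isometry(1) L2_cscale)
  then show "lift_op \<mu> V eV Q (lift_op \<mu> V eV Q A) = dint_scale \<mu> V eV (-1) A"
    using f by (simp add: lift_Q_cls dint_scale_cls Q_isometry(1))
next
  fix k :: nat and A assume k: "1 \<le> k" and A: "A \<in> direct_integral \<mu> V eV"
  let ?z = "\<lambda>x. - \<i> * (-1) ^ (\<Sum>j\<in>{1..<k}. coord j x)"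
  show "lift_op \<mu> V eV Q (lift_op \<mu> V eV (J_section \<mu> c k) A)
      = lift_op \<mu> V eV (J_section \<mu> c k) (lift_op \<mu> V eV Q A)"
  proof (rule lift_Q_commute[OF k _ _ _ _ A])
    show "?z \<in> borel_measurable (completion \<mu>)"
      by (intro borel_measurable_times phase_measurable borel_measurable_const)
    show "cmod (?z x) = 1" for x
      by (simp add: norm_mult norm_power)
    \<comment> \<open>The interval has k - 1 elements, and conjugating -i costs a further sign;
      hence the right-hand side is the negative of the factor in
      \<open>phase_unit_seq\<close>.\<close>
    have sign: "(-1) ^ (k - 1) * of_real (conj_sign k) = (if k = 1 then 1 else - 1 :: complex)"
      using k by (cases k) (simp_all add: conj_sign_def flip: power_add mult_2)
    show "(-1) ^ coord 1 x * cnj (?z (x \<boxplus> ones)) * of_real (conj_sign k)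
        = ?z x * (-1) ^ coord 1 (x \<boxplus> unit_seq k)" for x
    proof -
      have "(-1) ^ coord 1 x * cnj (?z (x \<boxplus> ones)) * of_real (conj_sign k)
          = \<i> * (-1) ^ coord 1 x * (-1) ^ (\<Sum>j\<in>{1..<k}. coord j x) * ((-1) ^ (k - 1) * of_real (conj_sign k))"
        unfolding phase_ones[OF finite_atLeastLessThan] by (simp add: mult_ac)
      also have "\<dots> = ?z x * (-1) ^ coord 1 (x \<boxplus> unit_seq k)"
        unfolding sign phase_unit_seq[OF k] by simp
      finally show ?thesis .
    qed
    show "J_section \<mu> c k = weighted_shift (unit_seq k) ?z (c k)"
      by (intro ext) (simp add: J_section_def weighted_shift_def)
  qed
next
  fix k :: nat and A assume k: "1 \<le> k" and A: "A \<in> direct_integral \<mu> V eV"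
  let ?z = "\<lambda>x. (-1) ^ (\<Sum>j\<in>{1..k}. coord j x) :: complex"
  show "lift_op \<mu> V eV Q (lift_op \<mu> V eV (J'_section \<mu> c k) A)
      = lift_op \<mu> V eV (J'_section \<mu> c k) (lift_op \<mu> V eV Q A)"
  proof (rule lift_Q_commute[OF k _ _ _ _ A])
    show "?z \<in> borel_measurable (completion \<mu>)"
      by (rule phase_measurable)
    show "cmod (?z x) = 1" for x
      by (simp add: norm_power)
    \<comment> \<open>With k coordinates and no factor i, the right-hand side is exactly the factor
      in \<open>phase_unit_seq\<close>.\<close>
    have sign: "(-1) ^ k * of_real (conj_sign k) = (if k = 1 then - 1 else 1 :: complex)"
      by (simp add: conj_sign_def flip: power_add mult_2)
    show "(-1) ^ coord 1 x * cnj (?z (x \<boxplus> ones)) * of_real (conj_sign k)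
        = ?z x * (-1) ^ coord 1 (x \<boxplus> unit_seq k)" for x
    proof -
      have "(-1) ^ coord 1 x * cnj (?z (x \<boxplus> ones)) * of_real (conj_sign k)
          = (-1) ^ coord 1 x * (-1) ^ (\<Sum>j\<in>{1..k}. coord j x) * ((-1) ^ k * of_real (conj_sign k))"
        unfolding phase_ones[OF finite_atLeastAtMost] by (simp add: mult_ac)
      also have "\<dots> = ?z x * (-1) ^ coord 1 (x \<boxplus> unit_seq k)"
        unfolding sign phase_unit_seq[OF k] by simp
      finally show ?thesis .
    qed
    show "J'_section \<mu> c k = weighted_shift (unit_seq k) ?z (c k)"
      by (intro ext) (simp add: J'_section_def weighted_shift_def)
  qed
qed

end

theorem theorem3p13:
  fixes \<mu> :: "binseq measure"
    and U :: "binseq \<Rightarrow> 'u::{real_inner,complete_space} set"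
    and e :: "nat \<Rightarrow> binseq \<Rightarrow> 'u"
    and \<nu> :: "binseq \<Rightarrow> enat"
    and c :: "nat \<Rightarrow> binseq \<Rightarrow> 'u \<times> 'u \<Rightarrow> 'u \<times> 'u"
  defines "V \<equiv> complexify_family U"
    and "eV \<equiv> complexify_sections e"
  assumes "real_measurable_family \<mu> U e"
    and "\<And>d. d \<in> fin_seqs \<Longrightarrow> real_translation_invariant \<mu> U e d"
    and "real_translation_invariant \<mu> U e ones"
    and "GW_triple \<mu> V eV \<nu> c"
    and "equivalent_measures (translate \<mu> ones) \<mu>"
    and "AE x in \<mu>. \<nu> (flip x) = \<nu> x"
    and "AE x in \<mu>. \<forall>v\<in>V x. conj_op (c 1 x) v = c 1 (flip x) v"
    and "\<And>k. k \<ge> 2 \<Longrightarrow> AE x in \<mu>. \<forall>v\<in>V x. conj_op (c k x) v = (-1) ^ k *\<^sub>R c k (flip x) v"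
  shows "invariant_quaternionic_structure \<mu> V eV c (lift_op \<mu> V eV (Q_section \<mu>))"
proof -
  have "binseq_measure \<mu>"
    using assms(6) by (simp add: binseq_measure_def binseq_measure_axioms_def GW_triple_def)
  then interpret quaternionic_GW \<mu> U e \<nu> c
    using assms(3-7,9,10) unfolding V_def eV_def
    by (simp add: quaternionic_GW_def quaternionic_GW_axioms_def real_family_def real_family_axioms_def)
  show ?thesis
    unfolding V_def eV_def Q_section_eq by (rule invariant_quaternionic_structure_Q)
qed

end
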